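(* Let $r\ge 1$ be an integer and let $\underline{n}=(n_1,\dots,n_{2r+1})\in\mathbb{N}^{2r+1}$ be a multi-index with all $n_i>0$. Then the simple Lie algebra $K(2r+1,\underline{n})^{(1)}$ over $\mathbb{F}$ is not generated by 1,5 elements.
   Context: $\mathbb{F}$ is an algebraically closed field of characteristic $p>3$. A Lie algebra $L$ over $\mathbb{F}$ is generated by 1,5 elements if for every $x\in L$ with $x\ne 0$ there exists $y\in L$ such that the Lie subalgebra generated by $x$ and $y$ is $L$. Divided power algebra: for $m\ge1$, $\mathcal{O}(m)$ is the commutative $\mathbb{F}$-algebra with basis $x^{(\alpha)}$, $\alpha\in\mathbb{N}^m$ ($\mathbb N$ contains $0$), and product $x^{(\alpha)}x^{(\beta)}=\binom{\alpha+\beta}{\alpha}x^{(\alpha+\beta)}$, where $\binom{\alpha}{\beta}=\prod_i\binom{\alpha_i}{\beta_i}$. For $\underline{n}\in\mathbb{N}^m$ with all $n_i>0$, $\mathcal{O}(m,\underline{n})$ is the subalgebra spanned by the $x^{(\alpha)}$ with $0\le\alpha_i\le p^{n_i}-1$ for all $i$. For $1\le k\le m$, $\epsilon_k$ is the $k$-th unit multi-index, $x_k=x^{(\epsilon_k)}$, and $\partial_k$ is the derivation of $\mathcal{O}(m,\underline{n})$ with $\partial_k(x^{(\alpha)})=x^{(\alpha-\epsilon_k)}$ (equal to $0$ if $\alpha_k=0$). The Lie algebra of special derivations is $W(m,\underline{n})=\bigoplus_{k=1}^m\mathcal{O}(m,\underline{n})\,\partial_k\subseteq\operatorname{Der}\mathcal{O}(m,\underline{n})$.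 Take $m=2r+1$. For $1\le j\le r$ put $j'=j+r$, $\sigma(j)=1$; for $r<j\le 2r$ put $j'=j-r$, $\sigma(j)=-1$. Define the linear map $D_K:\mathcal{O}(2r+1,\underline{n})\to W(2r+1,\underline{n})$ by $$D_K(f)=\sum_{j=1}^{2r}\big(\sigma(j)\partial_j(f)+x_{j'}\partial_m(f)\big)\partial_{j'}+\Big(2f-\sum_{j=1}^{2r}x_j\partial_j(f)\Big)\partial_{2r+1}.$$ It is injective, and $K(2r+1,\underline{n})$ is its image, a Lie subalgebra of $W(2r+1,\underline{n})$: one has $[D_K(f),D_K(g)]=D_K(\langle f,g\rangle)$ with $\langle f,g\rangle=D_K(f)(g)-2g\,\partial_m(f)$. $K(2r+1,\underline{n})^{(1)}=[K(2r+1,\underline{n}),K(2r+1,\underline{n})]$ is its derived subalgebra, which is known to be simple. *)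

theory Defs
  imports
    "HOL-Computational_Algebra.Computational_Algebra"
    "HOL-Library.Function_Algebras"
begin

section \<open>Lie subalgebras and generation\<close>

text \<open>
  A Lie algebra is given by its carrier \<open>L\<close>, a scalar multiplication \<open>scale\<close> and a bracket
  \<open>br\<close>; addition is that of the ambient type.
\<close>

definition lie_subalgebra ::
  "('a::field \<Rightarrow> 'v::ab_group_add \<Rightarrow> 'v) \<Rightarrow> ('v \<Rightarrow> 'v \<Rightarrow> 'v) \<Rightarrow> 'v set \<Rightarrow> 'v set \<Rightarrow> bool" where
  "lie_subalgebra scale br L S \<longleftrightarrow>
     S \<subseteq> L \<and> module.subspace scale S \<and> (\<forall>x\<in>S. \<forall>y\<in>S. br x y \<in> S)"

definition lie_generated ::
  "('a::field \<Rightarrow> 'v::ab_group_add \<Rightarrow> 'v) \<Rightarrow> ('v \<Rightarrow> 'v \<Rightarrow> 'v) \<Rightarrow> 'v set \<Rightarrow> 'v set \<Rightarrow> 'v set" where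
  "lie_generated scale br L X = lie_subalgebra scale br L hull X"

definition generated_by_one_and_half ::
  "('a::field \<Rightarrow> 'v::ab_group_add \<Rightarrow> 'v) \<Rightarrow> ('v \<Rightarrow> 'v \<Rightarrow> 'v) \<Rightarrow> 'v set \<Rightarrow> bool" where
  "generated_by_one_and_half scale br L \<longleftrightarrow>
     (\<forall>x\<in>L. x \<noteq> 0 \<longrightarrow> (\<exists>y\<in>L. lie_generated scale br L {x, y} = L))"

definition derived_subalgebra ::
  "('a::field \<Rightarrow> 'v::ab_group_add \<Rightarrow> 'v) \<Rightarrow> ('v \<Rightarrow> 'v \<Rightarrow> 'v) \<Rightarrow> 'v set \<Rightarrow> 'v set" where
  "derived_subalgebra scale br L = module.span scale {br x y | x y. x \<in> L \<and> y \<in> L}"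

section \<open>Divided power algebras\<close>

text \<open>
  A multi-index in \<open>\<nat>\<^sup>m\<close> is a function \<open>nat \<Rightarrow> nat\<close> vanishing outside \<open>{1..m}\<close>. An element of the
  divided power algebra is its coefficient function: \<open>f\<close> stands for the sum of the
  \<open>f \<alpha> \<cdot> x\<^sup>(\<^sup>\<alpha>\<^sup>)\<close>. Sums, differences and the order of multi-indices are pointwise.
\<close>

type_synonym mi = "nat \<Rightarrow> nat"
type_synonym 'a dp = "mi \<Rightarrow> 'a"

definition mi_unit :: "nat \<Rightarrow> mi" where
  "mi_unit k = (\<lambda>i. of_bool (i = k))"

definition mi_binom :: "nat \<Rightarrow> mi \<Rightarrow> mi \<Rightarrow> nat" where
  "mi_binom m \<alpha> \<beta> = (\<Prod>i=1..m. \<alpha> i choose \<beta> i)"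

definition dp_monom :: "mi \<Rightarrow> 'a::field dp" where
  "dp_monom \<alpha> = (\<lambda>\<beta>. of_bool (\<beta> = \<alpha>))"

definition dp_var :: "nat \<Rightarrow> 'a::field dp" where
  "dp_var k = dp_monom (mi_unit k)"

text \<open>The exponents are bounded in terms of the characteristic of the coefficient field.\<close>

definition dp_alg :: "nat \<Rightarrow> (nat \<Rightarrow> nat) \<Rightarrow> 'a::field dp set" where
  "dp_alg m n = {f. \<forall>\<alpha>. f \<alpha> \<noteq> 0 \<longrightarrow>
     (\<forall>i\<in>{1..m}. \<alpha> i \<le> CHAR('a) ^ n i - 1) \<and> (\<forall>i. i \<notin> {1..m} \<longrightarrow> \<alpha> i = 0)}"

text \<open>
  The bilinear extension of the product of monomials, read off at the coefficient of
  \<open>\<gamma> = \<alpha> + \<beta>\<close>; cf. \<open>dp_mult_monom\<close> below.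
\<close>

definition dp_mult :: "nat \<Rightarrow> 'a::field dp \<Rightarrow> 'a dp \<Rightarrow> 'a dp" where
  "dp_mult m f g = (\<lambda>\<gamma>. \<Sum>\<alpha> | \<alpha> \<le> \<gamma>. of_nat (mi_binom m \<gamma> \<alpha>) * f \<alpha> * g (\<gamma> - \<alpha>))"

definition dp_scale :: "'a::field \<Rightarrow> 'a dp \<Rightarrow> 'a dp" where
  "dp_scale c f = (\<lambda>\<alpha>. c * f \<alpha>)"

text \<open>
  The coefficient at \<open>\<alpha>\<close> of the \<open>k\<close>-th partial derivative comes from the monomial
  \<open>\<alpha> + \<epsilon>\<^sub>k\<close>; cf. \<open>dp_deriv_monom\<close> below.
\<close>

definition dp_deriv :: "nat \<Rightarrow> 'a::field dp \<Rightarrow> 'a dp" where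
  "dp_deriv k f = (\<lambda>\<alpha>. f (\<alpha> + mi_unit k))"

lemma finite_mi_below:
  fixes \<gamma> :: mi
  assumes "\<And>i. i \<notin> {1..m} \<Longrightarrow> \<gamma> i = 0"
  shows "finite {\<alpha>. \<alpha> \<le> \<gamma>}"
proof (rule finite_subset)
  let ?A = "{\<alpha>. \<forall>i. (i \<in> {1..m} \<longrightarrow> \<alpha> i \<in> {..Max (\<gamma> ` {1..m})}) \<and> (i \<notin> {1..m} \<longrightarrow> \<alpha> i = 0)}"
  show "finite ?A"
    by (intro finite_set_of_finite_funs) auto
  show "{\<alpha>. \<alpha> \<le> \<gamma>} \<subseteq> ?A"
  proof safe
    fix \<alpha> i assume le: "\<alpha> \<le> \<gamma>"
    show "\<alpha> i \<le> Max (\<gamma> ` {1..m})" if "i \<in> {1..m}"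
    proof -
      have "\<gamma> i \<le> Max (\<gamma> ` {1..m})"
        using that by (intro Max_ge) auto
      with le show ?thesis
        by (meson le_fun_def order_trans)
    qed
    show "\<alpha> i = 0" if "i \<notin> {1..m}"
      using le_funD[OF le, of i] assms[OF that] by simp
  qed
qed

lemma dp_mult_monom:
  assumes "\<And>i. i \<notin> {1..m} \<Longrightarrow> \<alpha> i = 0" "\<And>i. i \<notin> {1..m} \<Longrightarrow> \<beta> i = 0"
  shows "dp_mult m (dp_monom \<alpha>) (dp_monom \<beta>) =
           dp_scale (of_nat (mi_binom m (\<alpha> + \<beta>) \<alpha>)) (dp_monom (\<alpha> + \<beta>) :: 'a::field dp)"
proof
  fix \<gamma> :: mi
  let ?t = "\<lambda>\<delta>. of_nat (mi_binom m \<gamma> \<delta>) * dp_monom \<alpha> \<delta> * dp_monom \<beta> (\<gamma> - \<delta>) :: 'a"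
  show "dp_mult m (dp_monom \<alpha>) (dp_monom \<beta>) \<gamma> =
          dp_scale (of_nat (mi_binom m (\<alpha> + \<beta>) \<alpha>)) (dp_monom (\<alpha> + \<beta>) :: 'a dp) \<gamma>"
  proof (cases "\<gamma> = \<alpha> + \<beta>")
    case True
    have "finite {\<delta>. \<delta> \<le> \<gamma>}"
      by (rule finite_mi_below[of m]) (auto simp: True assms)
    moreover have "\<alpha> \<le> \<gamma>"
      by (auto simp: True le_fun_def)
    ultimately have "sum ?t {\<delta>. \<delta> \<le> \<gamma>} = sum ?t {\<alpha>}"
      by (intro sum.mono_neutral_right) (auto simp: dp_monom_def)
    moreover have "\<alpha> + \<beta> - \<alpha> = \<beta>"
      by (auto simp: fun_eq_iff)
    ultimately show ?thesis
      by (simp add: dp_mult_def dp_scale_def dp_monom_def True)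
  next
    case False
    have "?t \<delta> = 0" if "\<delta> \<le> \<gamma>" for \<delta>
    proof -
      have "\<gamma> = \<delta> + (\<gamma> - \<delta>)"
        using le_funD[OF that] by (auto simp: fun_eq_iff)
      with False have "\<not> (\<delta> = \<alpha> \<and> \<gamma> - \<delta> = \<beta>)"
        by metis
      then show ?thesis
        by (auto simp: dp_monom_def)
    qed
    then have "sum ?t {\<delta>. \<delta> \<le> \<gamma>} = 0"
      by (intro sum.neutral) auto
    with False show ?thesis
      by (simp add: dp_mult_def dp_scale_def dp_monom_def)
  qed
qed

lemma dp_deriv_monom:
  "dp_deriv k (dp_monom \<alpha>) =
     (if \<alpha> k = 0 then 0 else (dp_monom (\<alpha> - mi_unit k) :: 'a::field dp))"
proof
  fix \<beta> :: mi
  have "\<beta> + mi_unit k = \<alpha> \<longleftrightarrow> \<alpha> k \<noteq> 0 \<and> \<beta> = \<alpha> - mi_unit k"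
  proof
    assume "\<beta> + mi_unit k = \<alpha>"
    then show "\<alpha> k \<noteq> 0 \<and> \<beta> = \<alpha> - mi_unit k"
      by (auto simp: mi_unit_def)
  next
    assume "\<alpha> k \<noteq> 0 \<and> \<beta> = \<alpha> - mi_unit k"
    then show "\<beta> + mi_unit k = \<alpha>"
      by (auto simp: mi_unit_def fun_eq_iff)
  qed
  then show "dp_deriv k (dp_monom \<alpha>) \<beta> =
               (if \<alpha> k = 0 then 0 else (dp_monom (\<alpha> - mi_unit k) :: 'a dp)) \<beta>"
    by (auto simp: dp_deriv_def dp_monom_def)
qed

section \<open>Special derivations and contact algebras\<close>

text \<open>
  Linear operators on \<open>dp_alg m n\<close> are extended by zero to the whole type, so that two of them are
  equal iff they agree on \<open>dp_alg m n\<close>. The bracket is the commutator of operators.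
\<close>

type_synonym 'a dp_op = "'a dp \<Rightarrow> 'a dp"

definition op_scale :: "'a::field \<Rightarrow> 'a dp_op \<Rightarrow> 'a dp_op" where
  "op_scale c D = (\<lambda>h. dp_scale c (D h))"

definition op_bracket :: "'a::field dp_op \<Rightarrow> 'a dp_op \<Rightarrow> 'a dp_op" where
  "op_bracket D E = (\<lambda>h. D (E h) - E (D h))"

interpretation op: vector_space "op_scale :: 'a::field \<Rightarrow> 'a dp_op \<Rightarrow> 'a dp_op"
  by unfold_locales (auto simp: op_scale_def dp_scale_def fun_eq_iff algebra_simps)

text \<open>The derivation with coefficient \<open>c k\<close> at the \<open>k\<close>-th partial derivative.\<close>

definition special_derivation :: "nat \<Rightarrow> (nat \<Rightarrow> nat) \<Rightarrow> (nat \<Rightarrow> 'a::field dp) \<Rightarrow> 'a dp_op" where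
  "special_derivation m n c =
     (\<lambda>h. if h \<in> dp_alg m n then \<Sum>k=1..m. dp_mult m (c k) (dp_deriv k h) else 0)"

definition conj_index :: "nat \<Rightarrow> nat \<Rightarrow> nat" where
  "conj_index r j = (if j \<le> r then j + r else j - r)"

definition contact_sign :: "nat \<Rightarrow> nat \<Rightarrow> 'a::field" where
  "contact_sign r j = (if j \<le> r then 1 else -1)"

text \<open>
  The defining sum of \<open>D\<^sub>K(f)\<close> runs over \<open>j\<close>, with the \<open>j\<close>-th summand a multiple of the
  \<open>j'\<close>-th partial derivative. As \<open>j \<mapsto> j'\<close> is an involution of \<open>{1..2r}\<close>, the coefficient at
  the \<open>k\<close>-th one is the summand for \<open>j = k'\<close>.
\<close>

definition D_K :: "nat \<Rightarrow> (nat \<Rightarrow> nat) \<Rightarrow> 'a::field dp \<Rightarrow> 'a dp_op" where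
  "D_K r n f = (let m = 2 * r + 1 in
     special_derivation m n (\<lambda>k.
       if k = m then
         dp_scale 2 f - (\<Sum>j=1..2*r. dp_mult m (dp_var j) (dp_deriv j f))
       else
         (let j = conj_index r k in
           dp_scale (contact_sign r j) (dp_deriv j f) + dp_mult m (dp_var k) (dp_deriv m f))))"

definition contact_algebra :: "nat \<Rightarrow> (nat \<Rightarrow> nat) \<Rightarrow> 'a::field dp_op set" where
  "contact_algebra r n = D_K r n ` dp_alg (2 * r + 1) n"

definition contact_algebra_derived :: "nat \<Rightarrow> (nat \<Rightarrow> nat) \<Rightarrow> 'a::field dp_op set" where
  "contact_algebra_derived r n = derived_subalgebra op_scale op_bracket (contact_algebra r n)"

end

theory Submission
  imports Defs
begin

text \<open>
  Let \<open>A\<close> be the truncated divided power algebra, and let a contact derivation \<open>D\<^sub>K(f)\<close> be identified with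
  \<open>f\<close>. For every \<open>f\<close>, the monomial \<open>sub_top\<close>, which lies one step below the top exponent in the direction
  of the last variable \<open>x\<^sub>m\<close>, fails to generate the derived contact algebra together with \<open>f\<close>.

  Put \<open>E = D\<^sub>K(f)\<close>, acting on \<open>A\<close>, and let the core be the largest \<open>E\<close>-stable subspace of the maximal ideal
  of \<open>A\<close>. It is an ideal, because \<open>E\<close> is a derivation. The square of the core is closed under the contact
  bracket (\<open>bracket_core_square\<close>), since the bracket applies at most one derivative to either argument.
  It is also stable under the bracket with \<open>f\<close>, since \<open>\<langle>f, g\<rangle> = E g - 2 g \<partial>\<^sub>m f\<close>. So once \<open>sub_top\<close> is known to
  lie in the square of the core, the subalgebra generated by \<open>sub_top\<close> and \<open>f\<close> is contained in the sum
  of that square and the line of \<open>f\<close>. Modulo the square of the maximal ideal this is at most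
  one-dimensional, which is too small, because the derived algebra contains \<open>1\<close> and \<open>x\<^sub>1\<close>
  (\<open>not_generated\<close>).

  Suppose that the core contains an element \<open>w\<close> with a nonzero linear term. If \<open>sub_top\<close> were not in \<open>w\<^sup>2 A\<close>,
  then, as \<open>A\<close> is a Frobenius algebra, some \<open>c\<close> with \<open>c w\<^sup>2 = 0\<close> would be a unit or have a nonzero linear
  term. But in characteristic \<open>p > 3\<close> a product of three nonzero linear forms does not vanish
  (\<open>sub_top_in_square\<close>).

  It remains to find \<open>w\<close> (\<open>exists_linear_part_in_core\<close>). If the coefficients at \<open>x\<^sub>1\<close> and \<open>x\<^bsub>1 + r\<^esub>\<close> vanish
  on the core, they are linear combinations of the functionals that take the constant term of
  \<open>E\<^sup>j a\<close>. The same combinations of the powers of \<open>E\<close> are then derivations \<open>Q\<close> and \<open>Q'\<close>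
  (\<open>primitive_polyop\<close>). They commute with \<open>E\<close> and with each other, and at the origin they are \<open>\<partial>\<^sub>1\<close> and
  \<open>\<partial>\<^bsub>1 + r\<^esub>\<close>. As \<open>E\<close> preserves the contact form up to a factor, the contractions of the form with \<open>Q\<close> and \<open>Q'\<close>
  generate \<open>E\<close>-stable ideals modulo the core, so they lie in the core (\<open>contraction_in_core\<close>).
  Hence the differential of the contact form vanishes on \<open>Q\<close> and \<open>Q'\<close> at the origin, although
  \<open>\<partial>\<^sub>1\<close> and \<open>\<partial>\<^bsub>1 + r\<^esub>\<close> are conjugate directions.
\<close>

section \<open>The ring of divided power series\<close>

definition finite_mi :: "mi \<Rightarrow> bool" where
  "finite_mi \<alpha> \<longleftrightarrow> finite {i. \<alpha> i \<noteq> 0}"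

lemma finite_mi_0 [simp]: "finite_mi 0"
  by (simp add: finite_mi_def)

lemma finite_mi_unit [simp]: "finite_mi (mi_unit k)"
  by (simp add: finite_mi_def mi_unit_def)

lemma mi_le_zero: "\<alpha> \<le> \<gamma> \<Longrightarrow> \<gamma> i = 0 \<Longrightarrow> \<alpha> i = (0 :: nat)"
  by (metis le_funD le_zero_eq)

lemma finite_mi_mono:
  assumes "finite_mi \<gamma>" "\<alpha> \<le> \<gamma>"
  shows "finite_mi \<alpha>"
proof -
  have "{i. \<alpha> i \<noteq> 0} \<subseteq> {i. \<gamma> i \<noteq> 0}"
    using mi_le_zero[OF assms(2)] by (intro Collect_mono impI notI) metis
  then show ?thesis
    using assms(1) finite_subset by (auto simp: finite_mi_def)
qed

lemma finite_mi_add [simp]: "finite_mi (\<alpha> + \<beta>) \<longleftrightarrow> finite_mi \<alpha> \<and> finite_mi \<beta>"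
proof -
  have "{i. (\<alpha> + \<beta>) i \<noteq> 0} = {i. \<alpha> i \<noteq> 0} \<union> {i. \<beta> i \<noteq> 0}"
    by auto
  then show ?thesis
    by (simp add: finite_mi_def)
qed

lemma mi_le_diff_add: "\<alpha> \<le> \<gamma> \<Longrightarrow> \<alpha> + (\<gamma> - \<alpha>) = (\<gamma> :: mi)"
  by (auto simp: le_fun_def fun_eq_iff)

lemma finite_mi_induct [consumes 1, case_names zero add_unit]:
  assumes "finite_mi \<gamma>" "P 0" "\<And>\<gamma> k. finite_mi \<gamma> \<Longrightarrow> P \<gamma> \<Longrightarrow> P (\<gamma> + mi_unit k)"
  shows "P \<gamma>"
  using assms(1)
proof (induction "\<Sum>i | \<gamma> i \<noteq> 0. \<gamma> i" arbitrary: \<gamma> rule: less_induct)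
  case less
  show ?case
  proof (cases "\<gamma> = 0")
    case False
    then obtain k where k: "\<gamma> k \<noteq> 0"
      by (auto simp: fun_eq_iff)
    define \<beta> where "\<beta> = \<gamma> - mi_unit k"
    have \<gamma>: "\<gamma> = \<beta> + mi_unit k"
      using k by (auto simp: \<beta>_def mi_unit_def fun_eq_iff)
    have fin: "finite {i. \<gamma> i \<noteq> 0}" "finite_mi \<beta>"
      using less.prems \<gamma> by (simp_all only: finite_mi_def[symmetric] finite_mi_add)
    have "(\<Sum>i | \<beta> i \<noteq> 0. \<beta> i) = (\<Sum>i | \<gamma> i \<noteq> 0. \<beta> i)"
      using fin(1) by (intro sum.mono_neutral_left) (auto simp: \<gamma>)
    also have "\<dots> < (\<Sum>i | \<gamma> i \<noteq> 0. \<gamma> i)"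
      using fin(1) k by (intro sum_strict_mono_ex1) (auto simp: \<gamma> mi_unit_def intro!: exI[of _ k])
    finally show ?thesis
      using less.hyps fin(2) assms(3) \<gamma> by metis
  qed (use assms in simp)
qed

lemma finite_le_mi:
  assumes "finite_mi \<gamma>"
  shows "finite {\<alpha>. \<alpha> \<le> \<gamma>}"
proof (rule finite_subset)
  let ?I = "{i. \<gamma> i \<noteq> 0}"
  let ?A = "{\<alpha>. \<forall>i. (i \<in> ?I \<longrightarrow> \<alpha> i \<in> (\<Union>i\<in>?I. {..\<gamma> i})) \<and> (i \<notin> ?I \<longrightarrow> \<alpha> i = 0)}"
  show "finite ?A"
    using assms by (intro finite_set_of_finite_funs) (auto simp: finite_mi_def)
  show "{\<alpha>. \<alpha> \<le> \<gamma>} \<subseteq> ?A"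
    by (auto dest: le_funD mi_le_zero)
qed

definition mi_choose :: "mi \<Rightarrow> mi \<Rightarrow> nat" where
  "mi_choose \<gamma> \<alpha> = (\<Prod>i | \<gamma> i \<noteq> 0. \<gamma> i choose \<alpha> i)"

lemma mi_choose_superset:
  assumes "finite I" "{i. \<gamma> i \<noteq> 0} \<subseteq> I" "\<alpha> \<le> \<gamma>"
  shows "mi_choose \<gamma> \<alpha> = (\<Prod>i\<in>I. \<gamma> i choose \<alpha> i)"
  unfolding mi_choose_def
  using assms by (intro prod.mono_neutral_left) (auto simp: mi_le_zero)

lemma mi_choose_0 [simp]: "mi_choose \<gamma> 0 = 1"
  by (simp add: mi_choose_def)

definition dp_prod :: "'a::field dp \<Rightarrow> 'a dp \<Rightarrow> 'a dp" where
  "dp_prod f g = (\<lambda>\<gamma>. \<Sum>\<alpha> | \<alpha> \<le> \<gamma>. of_nat (mi_choose \<gamma> \<alpha>) * f \<alpha> * g (\<gamma> - \<alpha>))"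

text \<open>
  Pascal's rule in the \<open>k\<close>-th coordinate. All further properties of the product are derived from this
  Leibniz rule instead of from identities between multinomial coefficients.
\<close>

lemma dp_deriv_prod:
  assumes fin: "finite_mi \<gamma>"
  shows "dp_deriv k (dp_prod f g) \<gamma> = dp_prod (dp_deriv k f) g \<gamma> + dp_prod f (dp_deriv k g) \<gamma>"
proof -
  define u where "u = mi_unit k"
  define I where "I = insert k {i. \<gamma> i \<noteq> 0}"
  have I: "finite I" "k \<in> I"
    using fin by (auto simp: I_def finite_mi_def)
  define P where "P = (\<lambda>\<alpha>. \<Prod>i\<in>I - {k}. \<gamma> i choose \<alpha> i)"
  let ?S = "{\<alpha>. \<alpha> \<le> \<gamma> + u}"
  have finS: "finite ?S"
    using fin by (intro finite_le_mi) (simp add: u_def)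
  have choose: "mi_choose \<gamma> \<alpha> = P \<alpha> * (\<gamma> k choose \<alpha> k)" if "\<alpha> \<le> \<gamma>" for \<alpha>
    using mi_choose_superset[of I \<gamma> \<alpha>] I that
    by (auto simp: P_def I_def prod.remove[of _ k] mult.commute)
  have choose_Suc: "mi_choose (\<gamma> + u) \<alpha> = P \<alpha> * (Suc (\<gamma> k) choose \<alpha> k)" if "\<alpha> \<le> \<gamma> + u" for \<alpha>
  proof -
    have "mi_choose (\<gamma> + u) \<alpha> = (\<Prod>i\<in>I. (\<gamma> + u) i choose \<alpha> i)"
      using I that by (intro mi_choose_superset) (auto simp: I_def u_def mi_unit_def)
    also have "\<dots> = ((\<gamma> + u) k choose \<alpha> k) * (\<Prod>i\<in>I - {k}. (\<gamma> + u) i choose \<alpha> i)"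
      using I by (simp add: prod.remove)
    also have "(\<Prod>i\<in>I - {k}. (\<gamma> + u) i choose \<alpha> i) = P \<alpha>"
      unfolding P_def by (intro prod.cong) (auto simp: u_def mi_unit_def)
    also have "(\<gamma> + u) k = Suc (\<gamma> k)"
      by (simp add: u_def mi_unit_def)
    finally show ?thesis
      by (simp only: mult.commute)
  qed
  define c where "c = (\<lambda>\<alpha>. if \<alpha> k = 0 then 0 else (\<gamma> k choose (\<alpha> k - 1)))"
  have pascal: "(Suc (\<gamma> k) choose \<alpha> k) = (\<gamma> k choose \<alpha> k) + c \<alpha>" for \<alpha>
    by (cases "\<alpha> k") (auto simp: c_def)
  have "dp_deriv k (dp_prod f g) \<gamma> =
      (\<Sum>\<alpha>\<in>?S. of_nat (P \<alpha> * (\<gamma> k choose \<alpha> k)) * f \<alpha> * g (\<gamma> + u - \<alpha>) +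
        of_nat (P \<alpha> * c \<alpha>) * f \<alpha> * g (\<gamma> + u - \<alpha>))"
    unfolding dp_deriv_def dp_prod_def u_def[symmetric]
    by (intro sum.cong) (auto simp: choose_Suc pascal algebra_simps)
  also have "\<dots> = (\<Sum>\<alpha>\<in>?S. of_nat (P \<alpha> * (\<gamma> k choose \<alpha> k)) * f \<alpha> * g (\<gamma> + u - \<alpha>)) +
      (\<Sum>\<alpha>\<in>?S. of_nat (P \<alpha> * c \<alpha>) * f \<alpha> * g (\<gamma> + u - \<alpha>))" (is "_ = ?s1 + ?s2")
    by (rule sum.distrib)
  also have "?s1 = (\<Sum>\<alpha> | \<alpha> \<le> \<gamma>. of_nat (P \<alpha> * (\<gamma> k choose \<alpha> k)) * f \<alpha> * g (\<gamma> + u - \<alpha>))"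
  proof (rule sum.mono_neutral_right[OF finS])
    show "{\<alpha>. \<alpha> \<le> \<gamma>} \<subseteq> ?S"
      by (auto simp: le_fun_def intro: trans_le_add1)
    have "\<gamma> k choose \<alpha> k = 0" if le: "\<alpha> \<le> \<gamma> + u" and nle: "\<not> \<alpha> \<le> \<gamma>" for \<alpha>
    proof -
      obtain i where i: "\<not> \<alpha> i \<le> \<gamma> i"
        using nle unfolding le_fun_def by blast
      with le_funD[OF le, of i] have "i = k"
        by (cases "i = k") (auto simp: u_def mi_unit_def)
      with i show ?thesis
        by simp
    qed
    then show "\<forall>\<alpha>\<in>?S - {\<alpha>. \<alpha> \<le> \<gamma>}. of_nat (P \<alpha> * (\<gamma> k choose \<alpha> k)) * f \<alpha> * g (\<gamma> + u - \<alpha>) = 0"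
      by (intro ballI) (simp del: binomial_eq_0_iff)
  qed
  also have "\<dots> = dp_prod f (dp_deriv k g) \<gamma>"
    unfolding dp_prod_def
  proof (rule sum.cong)
    fix \<alpha> assume "\<alpha> \<in> {\<alpha>. \<alpha> \<le> \<gamma>}"
    then have "\<alpha> \<le> \<gamma>" by simp
    then have "\<gamma> + u - \<alpha> = \<gamma> - \<alpha> + u"
      by (auto simp: le_fun_def fun_eq_iff)
    with \<open>\<alpha> \<le> \<gamma>\<close> show "of_nat (P \<alpha> * (\<gamma> k choose \<alpha> k)) * f \<alpha> * g (\<gamma> + u - \<alpha>) =
        of_nat (mi_choose \<gamma> \<alpha>) * f \<alpha> * dp_deriv k g (\<gamma> - \<alpha>)"
      by (simp add: choose dp_deriv_def u_def)
  qed simp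
  also have "?s2 = (\<Sum>\<alpha>\<in>{\<alpha>. \<alpha> \<le> \<gamma> + u \<and> \<alpha> k \<noteq> 0}. of_nat (P \<alpha> * c \<alpha>) * f \<alpha> * g (\<gamma> + u - \<alpha>))"
    using finS by (intro sum.mono_neutral_right) (auto simp: c_def)
  also have "\<dots> = (\<Sum>\<beta> | \<beta> \<le> \<gamma>. of_nat (P (\<beta> + u) * c (\<beta> + u)) * f (\<beta> + u) * g (\<gamma> + u - (\<beta> + u)))"
  proof (rule sum.reindex_bij_witness[of _ "\<lambda>\<beta>. \<beta> + u" "\<lambda>\<alpha>. \<alpha> - u"])
    fix \<alpha> assume a: "\<alpha> \<in> {\<alpha>. \<alpha> \<le> \<gamma> + u \<and> \<alpha> k \<noteq> 0}"
    then show *: "\<alpha> - u + u = \<alpha>"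
      by (auto simp: u_def mi_unit_def fun_eq_iff)
    show "\<alpha> - u \<in> {\<beta>. \<beta> \<le> \<gamma>}"
      using a by (auto simp: le_fun_def diff_le_mono2 le_diff_conv)
    show "of_nat (P (\<alpha> - u + u) * c (\<alpha> - u + u)) * f (\<alpha> - u + u) * g (\<gamma> + u - (\<alpha> - u + u)) =
          of_nat (P \<alpha> * c \<alpha>) * f \<alpha> * g (\<gamma> + u - \<alpha>)"
      by (simp only: *)
  next
    fix \<beta> assume "\<beta> \<in> {\<beta>. \<beta> \<le> \<gamma>}"
    then show "\<beta> + u - u = \<beta>" "\<beta> + u \<in> {\<alpha>. \<alpha> \<le> \<gamma> + u \<and> \<alpha> k \<noteq> 0}"
      by (auto simp: le_fun_def fun_eq_iff u_def mi_unit_def)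
  qed
  also have "\<dots> = dp_prod (dp_deriv k f) g \<gamma>"
    unfolding dp_prod_def
  proof (rule sum.cong)
    fix \<beta> assume "\<beta> \<in> {\<alpha>. \<alpha> \<le> \<gamma>}"
    then have "\<beta> \<le> \<gamma>" by simp
    have "P (\<beta> + u) = P \<beta>"
      unfolding P_def by (intro prod.cong) (auto simp: u_def mi_unit_def)
    moreover have "c (\<beta> + u) = \<gamma> k choose \<beta> k"
      by (simp add: c_def u_def mi_unit_def)
    moreover have "\<gamma> + u - (\<beta> + u) = \<gamma> - \<beta>"
      by (auto simp: fun_eq_iff)
    ultimately show "of_nat (P (\<beta> + u) * c (\<beta> + u)) * f (\<beta> + u) * g (\<gamma> + u - (\<beta> + u)) =
        of_nat (mi_choose \<gamma> \<beta>) * dp_deriv k f \<beta> * g (\<gamma> - \<beta>)"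
      using \<open>\<beta> \<le> \<gamma>\<close> by (simp add: choose dp_deriv_def u_def)
  qed simp
  finally show ?thesis
    by simp
qed

lemma dp_prod_at_0: "dp_prod f g 0 = f 0 * g 0"
proof -
  have "{\<alpha>. \<alpha> \<le> (0 :: mi)} = {0}"
    by (auto simp: le_fun_def fun_eq_iff)
  moreover have "(0 :: mi) - 0 = 0"
    by (simp add: fun_eq_iff)
  ultimately show ?thesis
    by (simp add: dp_prod_def)
qed

lemma dp_prod_not_finite_mi:
  assumes "\<And>\<alpha>. \<not> finite_mi \<alpha> \<Longrightarrow> f \<alpha> = 0" "\<And>\<alpha>. \<not> finite_mi \<alpha> \<Longrightarrow> g \<alpha> = 0" "\<not> finite_mi \<gamma>"
  shows "dp_prod f g \<gamma> = 0"
  unfolding dp_prod_def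
proof (rule sum.neutral, safe)
  fix \<alpha> assume "\<alpha> \<le> \<gamma>"
  then have "\<not> finite_mi \<alpha> \<or> \<not> finite_mi (\<gamma> - \<alpha>)"
    using assms(3) mi_le_diff_add finite_mi_add by metis
  then show "of_nat (mi_choose \<gamma> \<alpha>) * f \<alpha> * g (\<gamma> - \<alpha>) = 0"
    using assms by auto
qed

text \<open>
  Series in all the variables \<open>x\<^sub>i\<close>, \<open>i \<in> \<nat>\<close>, at once: this makes one type, hence one commutative ring,
  that contains the algebras \<open>O(m, n)\<close> for all \<open>m\<close> and \<open>n\<close> as subrings. Exponents of infinite support
  must be excluded because the product at such an exponent would be an infinite sum.
\<close>

typedef (overloaded) 'a dpower = "{f :: mi \<Rightarrow> 'a::field. \<forall>\<alpha>. \<not> finite_mi \<alpha> \<longrightarrow> f \<alpha> = 0}"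
  morphisms coef Abs_dpower
  by (rule exI[of _ 0]) simp

setup_lifting type_definition_dpower

lemma coef_not_finite_mi: "\<not> finite_mi \<alpha> \<Longrightarrow> coef f \<alpha> = 0"
  using coef[of f] by simp

lemma dpower_eqI: "(\<And>\<alpha>. finite_mi \<alpha> \<Longrightarrow> coef f \<alpha> = coef g \<alpha>) \<Longrightarrow> f = g"
  by (metis coef_inject coef_not_finite_mi ext)

lift_definition deriv :: "nat \<Rightarrow> 'a::field dpower \<Rightarrow> 'a dpower" is dp_deriv
  by (simp add: dp_deriv_def)

lift_definition const :: "'a::field \<Rightarrow> 'a dpower" is "\<lambda>c \<alpha>. if \<alpha> = 0 then c else 0"
  by auto

lift_definition dmonom :: "mi \<Rightarrow> 'a::field dpower" is "\<lambda>\<alpha>. if finite_mi \<alpha> then dp_monom \<alpha> else 0"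
  by (auto simp: dp_monom_def)

instantiation dpower :: (field) "{zero, one, plus, minus, uminus, times}"
begin

lift_definition zero_dpower :: "'a dpower" is 0 by simp
lift_definition one_dpower :: "'a dpower" is "\<lambda>\<alpha>. if \<alpha> = 0 then 1 else 0" by auto
lift_definition plus_dpower :: "'a dpower \<Rightarrow> 'a dpower \<Rightarrow> 'a dpower" is "(+)" by simp
lift_definition minus_dpower :: "'a dpower \<Rightarrow> 'a dpower \<Rightarrow> 'a dpower" is "(-)" by simp
lift_definition uminus_dpower :: "'a dpower \<Rightarrow> 'a dpower" is uminus by simp
lift_definition times_dpower :: "'a dpower \<Rightarrow> 'a dpower \<Rightarrow> 'a dpower" is dp_prod
  by (simp add: dp_prod_not_finite_mi)

instance ..

end

lemmas coef_simps [simp] =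
  zero_dpower.rep_eq plus_dpower.rep_eq minus_dpower.rep_eq uminus_dpower.rep_eq

instance dpower :: (field) ab_group_add
  by standard (auto intro!: dpower_eqI)

lemma coef_deriv: "coef (deriv k f) \<alpha> = coef f (\<alpha> + mi_unit k)"
  by (simp add: deriv.rep_eq dp_deriv_def)

lemma deriv_simps [simp]:
  "deriv k 0 = 0" "deriv k (f + g) = deriv k f + deriv k g" "deriv k (- f) = - deriv k f"
  "deriv k (f - g) = deriv k f - deriv k g"
  by (auto intro!: dpower_eqI simp: coef_deriv)

lemma deriv_const [simp]: "deriv k (const c) = 0"
  by (rule dpower_eqI) (auto simp: coef_deriv const.rep_eq fun_eq_iff mi_unit_def)

lemma const_1: "const 1 = 1"
  by (rule dpower_eqI) (simp add: const.rep_eq one_dpower.rep_eq)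

lemma deriv_1 [simp]: "deriv k 1 = 0"
  using deriv_const[of k 1] by (simp add: const_1)

lemma deriv_mult: "deriv k (f * g) = deriv k f * g + f * deriv k g"
  by (rule dpower_eqI) (simp add: deriv.rep_eq times_dpower.rep_eq dp_deriv_prod)

lemma deriv_commute: "deriv k (deriv l f) = deriv l (deriv k f)"
  by (rule dpower_eqI) (simp only: coef_deriv ac_simps)

lemma coef_mult_0 [simp]: "coef (f * g) 0 = coef f 0 * coef g 0"
  by (simp add: times_dpower.rep_eq dp_prod_at_0)

lemma dpower_distrib: "(f + g) * h = f * h + g * (h :: 'a::field dpower)"
  by (rule dpower_eqI) (simp add: times_dpower.rep_eq dp_prod_def sum.distrib algebra_simps)

lemma dpower_distrib': "h * (f + g) = h * f + h * (g :: 'a::field dpower)"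
  by (rule dpower_eqI) (simp add: times_dpower.rep_eq dp_prod_def sum.distrib algebra_simps)

text \<open>
  A series is determined by the constant terms of its iterated derivatives. Taking constant terms is
  multiplicative and the Leibniz rule has the same shape on both sides of each ring law, so the laws
  follow by induction on the exponent.
\<close>

instance dpower :: (field) comm_ring_1
proof
  fix a b c :: "'a dpower"
  show comm: "a * b = b * a" for a b :: "'a dpower"
  proof (rule dpower_eqI)
    fix \<alpha> assume "finite_mi \<alpha>"
    then show "coef (a * b) \<alpha> = coef (b * a) \<alpha>"
    proof (induction \<alpha> arbitrary: a b rule: finite_mi_induct)
      case (add_unit \<alpha> k)
      have "coef (deriv k (a * b)) \<alpha> = coef (deriv k (b * a)) \<alpha>"
        unfolding deriv_mult by (simp add: add_unit.IH[of "deriv k a"] add_unit.IH[of a])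
      then show ?case by (simp only: coef_deriv)
    qed simp
  qed
  show "a * b * c = a * (b * c)"
  proof (rule dpower_eqI)
    fix \<alpha> assume "finite_mi \<alpha>"
    then show "coef (a * b * c) \<alpha> = coef (a * (b * c)) \<alpha>"
    proof (induction \<alpha> arbitrary: a b c rule: finite_mi_induct)
      case (add_unit \<alpha> k)
      have "coef (deriv k (a * b * c)) \<alpha> = coef (deriv k (a * (b * c))) \<alpha>"
        unfolding deriv_mult dpower_distrib dpower_distrib' by (simp add: add_unit.IH)
      then show ?case by (simp only: coef_deriv)
    qed simp
  qed
  show "1 * a = a"
  proof (rule dpower_eqI)
    fix \<alpha> assume "finite_mi \<alpha>"
    then show "coef (1 * a) \<alpha> = coef a \<alpha>"
    proof (induction \<alpha> arbitrary: a rule: finite_mi_induct)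
      case zero
      then show ?case by (simp only: coef_mult_0 one_dpower.rep_eq) (simp add: zero_fun_def)
    next
      case (add_unit \<alpha> k)
      have "0 * a = 0" for a :: "'a dpower"
        by (rule dpower_eqI) (simp add: times_dpower.rep_eq dp_prod_def)
      then have "coef (deriv k (1 * a)) \<alpha> = coef (deriv k a) \<alpha>"
        by (simp add: deriv_mult add_unit.IH)
      then show ?case by (simp only: coef_deriv)
    qed
  qed
  show "(a + b) * c = a * c + b * c"
    by (rule dpower_distrib)
  show "(0 :: 'a dpower) \<noteq> 1"
    by (metis (mono_tags) one_dpower.rep_eq zero_dpower.rep_eq zero_fun_apply zero_neq_one)
qed


lemma coef_const_mult [simp]: "coef (const c * f) \<alpha> = c * coef f \<alpha>"
proof (cases "finite_mi \<alpha>")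
  case True
  then show ?thesis
  proof (induction \<alpha> arbitrary: f rule: finite_mi_induct)
    case zero
    then show ?case by (simp only: coef_mult_0 const.rep_eq) (simp add: zero_fun_def)
  next
    case (add_unit \<alpha> k)
    have "coef (deriv k (const c * f)) \<alpha> = c * coef (deriv k f) \<alpha>"
      by (simp add: deriv_mult add_unit.IH)
    then show ?case by (simp only: coef_deriv)
  qed
qed (simp add: coef_not_finite_mi)

lemma coef_const_0 [simp]: "coef (const c) 0 = c" "coef 1 0 = 1"
  by (simp_all add: const.rep_eq one_dpower.rep_eq)

lemma const_simps [simp]:
  "const 0 = 0" "const 1 = 1"
  by (auto intro!: dpower_eqI simp: const.rep_eq one_dpower.rep_eq)

lemma const_add: "const (a + b) = const a + const b"
  and const_minus: "const (- a) = - const a"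
  and const_mult: "const (a * b) = const a * const b"
  by (auto intro!: dpower_eqI simp: const.rep_eq)

lemma of_nat_dpower: "of_nat k = const (of_nat k)"
  by (induction k) (simp_all add: const_add)

lemma coef_sum: "coef (sum f S) \<alpha> = (\<Sum>i\<in>S. coef (f i) \<alpha>)"
  by (induction S rule: infinite_finite_induct) auto

lemma coef_sum_fun: "coef (sum g S) = (\<Sum>i\<in>S. coef (g i))"
  by (induction S rule: infinite_finite_induct) auto

lemma const_numeral [simp]: "const (numeral k) = numeral k"
  by (metis of_nat_dpower of_nat_numeral)

lemma deriv_sum: "deriv k (sum f S) = (\<Sum>i\<in>S. deriv k (f i))"
  by (induction S rule: infinite_finite_induct) auto

lemma coef_dmonom: "finite_mi \<alpha> \<Longrightarrow> coef (dmonom \<alpha>) \<beta> = of_bool (\<beta> = \<alpha>)"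
  by (simp add: dmonom.rep_eq dp_monom_def)

definition var :: "nat \<Rightarrow> 'a::field dpower" where
  "var k = dmonom (mi_unit k)"

lemma mi_unit_neq_0 [simp]: "mi_unit k \<noteq> 0" "0 \<noteq> mi_unit k"
  by (auto simp: mi_unit_def fun_eq_iff)

lemma coef_var_0 [simp]: "coef (var k) 0 = 0"
  by (simp add: var_def coef_dmonom)

lemma deriv_dmonom:
  "finite_mi \<alpha> \<Longrightarrow> deriv k (dmonom \<alpha>) = (if \<alpha> k = 0 then 0 else dmonom (\<alpha> - mi_unit k))"
proof (rule dpower_eqI)
  fix \<beta> assume "finite_mi \<alpha>"
  moreover have "finite_mi (\<alpha> - mi_unit k)"
    using calculation unfolding finite_mi_def by (rule rev_finite_subset) auto
  ultimately show "coef (deriv k (dmonom \<alpha>)) \<beta> =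
      coef (if \<alpha> k = 0 then 0 else dmonom (\<alpha> - mi_unit k)) \<beta>"
    by (simp add: deriv.rep_eq dmonom.rep_eq dp_deriv_monom)
qed

lemma deriv_var: "deriv k (var l) = (if k = l then 1 else 0)"
proof -
  have "mi_unit k - mi_unit k = (0 :: mi)"
    by (simp add: fun_eq_iff)
  moreover have "dmonom 0 = (1 :: 'a dpower)"
    by (rule dpower_eqI) (simp add: dmonom.rep_eq dp_monom_def one_dpower.rep_eq)
  moreover have "mi_unit l k = of_bool (k = l)"
    by (simp add: mi_unit_def)
  ultimately show ?thesis
    by (simp add: var_def deriv_dmonom)
qed

section \<open>Derivations\<close>

definition derivation :: "('a::field dpower \<Rightarrow> 'a dpower) \<Rightarrow> bool" where
  "derivation D \<longleftrightarrow> (\<forall>a b. D (a + b) = D a + D b) \<and> (\<forall>a b. D (a * b) = D a * b + a * D b) \<and>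
     (\<forall>c. D (const c) = 0)"

lemma derivation_deriv: "derivation (deriv k)"
  by (simp add: derivation_def deriv_mult)

lemma derivation_add: "derivation d \<Longrightarrow> derivation e \<Longrightarrow> derivation (\<lambda>a. d a + e a)"
  unfolding derivation_def by (auto simp: algebra_simps)

lemma derivationD:
  assumes "derivation D"
  shows "D (a + b) = D a + D b" "D (a * b) = D a * b + a * D b" "D (const c) = 0"
    "D 0 = 0" "D 1 = 0" "D (- a) = - D a" "D (a - b) = D a - D b"
    "D (const c * a) = const c * D a" "D (sum g S) = (\<Sum>i\<in>S. D (g i))" "D (of_nat k) = 0"
proof -
  show *: "D (a + b) = D a + D b" "D (a * b) = D a * b + a * D b" "D (const c) = 0" for a b c
    using assms by (auto simp: derivation_def)
  show 0: "D 0 = 0" "D 1 = 0"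
    using *(3)[of 0] *(3)[of 1] by simp_all
  show m: "D (- a) = - D a" for a
    using *(1)[of a "- a"] 0 by (simp add: add_eq_0_iff)
  show "D (a - b) = D a - D b"
    using *(1)[of a "- b"] m by simp
  show "D (const c * a) = const c * D a" "D (of_nat k) = 0" for c
    by (simp_all add: * of_nat_dpower)
  show "D (sum g S) = (\<Sum>i\<in>S. D (g i))"
    by (induction S rule: infinite_finite_induct) (auto simp: * 0)
qed

lemma derivation_power_linear:
  assumes "derivation D"
  shows "(D ^^ j) (a + b) = (D ^^ j) a + (D ^^ j) b" "(D ^^ j) (const c * a) = const c * (D ^^ j) a"
    "(D ^^ j) (sum g S) = (\<Sum>i\<in>S. (D ^^ j) (g i))" "(D ^^ j) 0 = 0" "(D ^^ j) (a - b) = (D ^^ j) a - (D ^^ j) b"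
  by (induction j) (simp_all add: derivationD[OF assms])

lemma derivation_power_mult:
  assumes "derivation D"
  shows "(D ^^ j) (a * b) = (\<Sum>i\<le>j. of_nat (j choose i) * ((D ^^ i) a * (D ^^ (j - i)) b))"
proof (induction j)
  case (Suc j)
  let ?t = "\<lambda>k i. (D ^^ i) a * (D ^^ (k - i)) b"
  have "(D ^^ Suc j) (a * b) =
      (\<Sum>i\<le>j. of_nat (j choose i) * (?t (Suc j) (Suc i) + ?t (Suc j) i))"
    by (simp add: Suc derivationD[OF assms] Suc_diff_le)
  also have "\<dots> = (\<Sum>i\<le>j. of_nat (j choose i) * ?t (Suc j) (Suc i)) +
      (\<Sum>i\<le>j. of_nat (j choose i) * ?t (Suc j) i)"
    by (simp add: distrib_left sum.distrib)
  also have "(\<Sum>i\<le>j. of_nat (j choose i) * ?t (Suc j) i) =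
      (\<Sum>i\<le>Suc j. of_nat (j choose i) * ?t (Suc j) i)"
    by (simp add: binomial_eq_0)
  also have "\<dots> = ?t (Suc j) 0 + (\<Sum>i\<le>j. of_nat (j choose Suc i) * ?t (Suc j) (Suc i))"
    by (subst sum.atMost_Suc_shift) (simp add: binomial_eq_0)
  also have "(\<Sum>i\<le>j. of_nat (j choose i) * ?t (Suc j) (Suc i)) + \<dots> =
      ?t (Suc j) 0 + (\<Sum>i\<le>j. of_nat (Suc j choose Suc i) * ?t (Suc j) (Suc i))"
    by (simp add: sum.distrib[symmetric] distrib_right add_ac)
  also have "\<dots> = (\<Sum>i\<le>Suc j. of_nat (Suc j choose i) * ?t (Suc j) i)"
    by (subst sum.atMost_Suc_shift) simp
  finally show ?case .
qed simp

section \<open>Binomial coefficients in positive characteristic\<close>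

lemma of_nat_binomial_prime_power:
  assumes "CHAR('a::field) > 0" "0 < k" "k < CHAR('a) ^ e"
  shows "of_nat (CHAR('a) ^ e choose k) = (0 :: 'a)"
proof -
  let ?p = "CHAR('a)"
  have p: "prime ?p"
    using assms by (intro prime_CHAR_semidom)
  have "k * (?p ^ e choose k) = ?p ^ e * ((?p ^ e - 1) choose (k - 1))"
    using assms by (intro times_binomial_minus1_eq)
  then have dvd: "?p ^ e dvd k * (?p ^ e choose k)"
    by simp
  have "?p dvd (?p ^ e choose k)"
  proof (rule ccontr)
    assume "\<not> ?p dvd (?p ^ e choose k)"
    then have "coprime (?p ^ e) (?p ^ e choose k)"
      using p by (simp add: prime_imp_coprime)
    then have "?p ^ e dvd k"
      using dvd by (simp add: coprime_dvd_mult_left_iff)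
    then show False
      using assms(2,3) by (auto dest: dvd_imp_le)
  qed
  then show ?thesis
    by (simp add: of_nat_eq_0_iff_char_dvd)
qed

text \<open>
  Since the inner coefficients of \<open>p\<^sup>e\<close> vanish, Pascal's rule makes the coefficients of \<open>p\<^sup>e - 1\<close>
  alternate between \<open>1\<close> and \<open>-1\<close>.
\<close>

lemma of_nat_binomial_prime_power_minus_1:
  assumes "CHAR('a::field) > 0" "k < CHAR('a) ^ e"
  shows "of_nat (CHAR('a) ^ e - 1 choose k) \<noteq> (0 :: 'a)"
  using assms(2)
proof (induction k)
  case (Suc k)
  let ?q = "CHAR('a) ^ e"
  have "?q choose Suc k = (?q - 1 choose k) + (?q - 1 choose Suc k)"
    using Suc.prems by (cases ?q) auto
  moreover have "of_nat (?q choose Suc k) = (0 :: 'a)"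
    using Suc.prems assms(1) by (intro of_nat_binomial_prime_power) auto
  ultimately have "of_nat (?q - 1 choose Suc k) = - (of_nat (?q - 1 choose k) :: 'a)"
    by (metis add.commute add_eq_0_iff2 of_nat_add)
  with Suc show ?case
    by simp
qed simp

section \<open>Truncated divided power algebras\<close>

text \<open>
  The parameter \<open>ty\<close> only serves to fix the field of coefficients, whose characteristic bounds the
  exponents.
\<close>

locale truncation =
  fixes m :: nat and n :: "nat \<Rightarrow> nat" and ty :: "'a::field itself"
  assumes char_pos: "CHAR('a) > 0"
begin

definition A :: "'a dpower set" where
  "A = {a. coef a \<in> dp_alg m n}"

definition top_mi :: mi where
  "top_mi = (\<lambda>i. if i \<in> {1..m} then CHAR('a) ^ n i - 1 else 0)"

lemma A_iff_le_top: "a \<in> A \<longleftrightarrow> (\<forall>\<alpha>. coef a \<alpha> \<noteq> 0 \<longrightarrow> \<alpha> \<le> top_mi)"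
  unfolding A_def dp_alg_def top_mi_def le_fun_def by auto

lemma finite_top [simp]: "finite_mi top_mi"
  unfolding finite_mi_def top_mi_def by (rule finite_subset[of _ "{1..m}"]) auto

lemma finite_le_top [simp]: "finite {\<alpha>. \<alpha> \<le> top_mi}" "\<alpha> \<le> top_mi \<Longrightarrow> finite_mi \<alpha>"
  using finite_le_mi[OF finite_top] finite_mi_mono[OF finite_top] by auto

lemma coef_deriv_power: "coef ((deriv k ^^ j) a) \<alpha> = coef a (\<alpha> + (\<lambda>i. if i = k then j else 0))"
proof (induction j arbitrary: a)
  case (Suc j)
  have "\<alpha> + (\<lambda>i. if i = k then j else 0) + mi_unit k = \<alpha> + (\<lambda>i. if i = k then Suc j else 0)"
    by (auto simp: fun_eq_iff mi_unit_def)
  then show ?case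
    by (simp only: funpow_Suc_right comp_def Suc coef_deriv)
qed (simp add: zero_fun_def[symmetric])

text \<open>
  The truncation is the common kernel of \<open>\<partial>\<^sub>i\<close> to the power \<open>q\<^sub>i = CHAR('a) ^ n i\<close> for \<open>i \<le> m\<close> and of \<open>\<partial>\<^sub>i\<close> for the other
  \<open>i\<close>. In characteristic \<open>p\<close> these operators are themselves derivations, and the common kernel of
  derivations is closed under products.
\<close>

lemma A_iff_deriv:
  "a \<in> A \<longleftrightarrow> (\<forall>i\<in>{1..m}. (deriv i ^^ (CHAR('a) ^ n i)) a = 0) \<and> (\<forall>i. i \<notin> {1..m} \<longrightarrow> deriv i a = 0)"
    (is "_ \<longleftrightarrow> ?R")
proof
  assume a: "a \<in> A"
  have *: "coef a \<alpha> = 0" if "\<alpha> i > top_mi i" for \<alpha> i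
    using a that unfolding A_iff_le_top le_fun_def by (metis leD)
  show ?R
  proof (intro conjI ballI allI impI; rule dpower_eqI)
    fix i \<alpha> assume "i \<in> {1..m}"
    then have "top_mi i < CHAR('a) ^ n i"
      using zero_less_power[OF char_pos, of "n i"] by (simp add: top_mi_def)
    then have "coef a (\<alpha> + (\<lambda>k. if k = i then CHAR('a) ^ n i else 0)) = 0"
      by (intro *[of i]) simp
    then show "coef ((deriv i ^^ (CHAR('a) ^ n i)) a) \<alpha> = coef 0 \<alpha>"
      by (simp add: coef_deriv_power)
  next
    fix i \<alpha> assume "i \<notin> {1..m}"
    then show "coef (deriv i a) \<alpha> = coef 0 \<alpha>"
      using *[of i "\<alpha> + mi_unit i"] by (auto simp: coef_deriv top_mi_def mi_unit_def)
  qed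
next
  assume R: ?R
  show "a \<in> A"
    unfolding A_iff_le_top le_fun_def
  proof (intro allI impI)
    fix \<alpha> i assume nz: "coef a \<alpha> \<noteq> 0"
    define q where "q = (if i \<in> {1..m} then CHAR('a) ^ n i else 1)"
    have "(deriv i ^^ q) a = 0"
      using R by (auto simp: q_def)
    then have 0: "coef a (\<beta> + (\<lambda>k. if k = i then q else 0)) = 0" for \<beta>
      by (metis coef_deriv_power coef_simps(1) zero_fun_apply)
    have "\<alpha> = (\<alpha> - (\<lambda>k. if k = i then q else 0)) + (\<lambda>k. if k = i then q else 0)" if "\<alpha> i \<ge> q"
      using that by (auto simp: fun_eq_iff)
    then have "\<alpha> i < q"
      using nz 0 by (metis not_le)
    then show "\<alpha> i \<le> top_mi i"
      by (auto simp: q_def top_mi_def split: if_splits)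
  qed
qed

lemma A_closed [simp]:
  "0 \<in> A" "1 \<in> A" "const c \<in> A" "a \<in> A \<Longrightarrow> b \<in> A \<Longrightarrow> a + b \<in> A" "a \<in> A \<Longrightarrow> b \<in> A \<Longrightarrow> a - b \<in> A"
  "a \<in> A \<Longrightarrow> - a \<in> A" "a \<in> A \<Longrightarrow> const c * a \<in> A" "a \<in> A \<Longrightarrow> deriv k a \<in> A"
proof -
  show "0 \<in> A"
    by (simp add: A_iff_le_top)
  show c: "const c \<in> A" for c
    by (auto simp: A_iff_le_top const.rep_eq le_fun_def)
  show "1 \<in> A"
    using c[of 1] by simp
  show "a \<in> A \<Longrightarrow> b \<in> A \<Longrightarrow> a + b \<in> A" "a \<in> A \<Longrightarrow> b \<in> A \<Longrightarrow> a - b \<in> A" "a \<in> A \<Longrightarrow> - a \<in> A"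
    "a \<in> A \<Longrightarrow> const c * a \<in> A"
    unfolding A_iff_le_top by auto (metis add.right_neutral, metis diff_zero)
  show "a \<in> A \<Longrightarrow> deriv k a \<in> A"
    unfolding A_iff_le_top by (auto simp: coef_deriv le_fun_def) (metis add_leD1 plus_fun_apply)
qed

lemma A_mult [simp]:
  assumes "a \<in> A" "b \<in> A"
  shows "a * b \<in> A"
  unfolding A_iff_deriv
proof (intro conjI ballI allI impI)
  fix i assume i: "i \<in> {1..m}"
  let ?q = "CHAR('a) ^ n i"
  have "(deriv i ^^ ?q) (a * b) =
      (\<Sum>j\<le>?q. of_nat (?q choose j) * ((deriv i ^^ j) a * (deriv i ^^ (?q - j)) b))"
    by (rule derivation_power_mult[OF derivation_deriv])
  also have "\<dots> = 0"
  proof (rule sum.neutral, rule ballI)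
    fix j assume "j \<in> {..?q}"
    then consider "j = 0" | "j = ?q" | "0 < j" "j < ?q"
      by fastforce
    then show "of_nat (?q choose j) * ((deriv i ^^ j) a * (deriv i ^^ (?q - j)) b) = 0"
    proof cases
      case 3
      then show ?thesis
        using char_pos by (simp add: of_nat_dpower of_nat_binomial_prime_power)
    qed (use assms i in \<open>auto simp: A_iff_deriv\<close>)
  qed
  finally show "(deriv i ^^ ?q) (a * b) = 0" .
next
  fix i assume "i \<notin> {1..m}"
  then show "deriv i (a * b) = 0"
    using assms by (simp add: deriv_mult A_iff_deriv)
qed

lemma A_sum [simp]: "(\<And>i. i \<in> S \<Longrightarrow> f i \<in> A) \<Longrightarrow> sum f S \<in> A"
  by (induction S rule: infinite_finite_induct) auto

lemma A_dmonom [simp]: "\<alpha> \<le> top_mi \<Longrightarrow> dmonom \<alpha> \<in> A"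
  by (simp add: A_iff_le_top coef_dmonom)

lemma A_expand:
  assumes "a \<in> A"
  shows "a = (\<Sum>\<alpha> | \<alpha> \<le> top_mi. const (coef a \<alpha>) * dmonom \<alpha>)"
proof (rule dpower_eqI)
  fix \<beta>
  have "coef (\<Sum>\<alpha> | \<alpha> \<le> top_mi. const (coef a \<alpha>) * dmonom \<alpha>) \<beta> =
      (\<Sum>\<alpha> | \<alpha> \<le> top_mi. if \<alpha> = \<beta> then coef a \<beta> else 0)"
    unfolding coef_sum by (intro sum.cong) (auto simp: coef_dmonom)
  also have "\<dots> = coef a \<beta>"
    using assms by (auto simp: A_iff_le_top)
  finally show "coef a \<beta> = coef (\<Sum>\<alpha> | \<alpha> \<le> top_mi. const (coef a \<alpha>) * dmonom \<alpha>) \<beta>"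
    by simp
qed

definition subspace :: "'a dpower set \<Rightarrow> bool" where
  "subspace S \<longleftrightarrow> S \<subseteq> A \<and> 0 \<in> S \<and> (\<forall>a\<in>S. \<forall>b\<in>S. a + b \<in> S) \<and> (\<forall>c. \<forall>a\<in>S. const c * a \<in> S)"

text \<open>
  The truncation has the monomials below \<open>top_mi\<close> as a finite basis; in this basis, linear functionals
  on it are represented by its own elements through the coordinatewise pairing.
\<close>

definition pairing :: "'a dpower \<Rightarrow> 'a dpower \<Rightarrow> 'a" where
  "pairing a b = (\<Sum>\<alpha> | \<alpha> \<le> top_mi. coef a \<alpha> * coef b \<alpha>)"

text \<open>
  A functional that vanishes on \<open>S\<close> but not at \<open>v\<close> is obtained by extending a basis of \<open>S\<close> by \<open>v\<close>.
\<close>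

lemma separation:
  assumes S: "subspace S" and v: "v \<in> A" "v \<notin> S"
  obtains b where "b \<in> A" "pairing v b \<noteq> 0" "\<And>s. s \<in> S \<Longrightarrow> pairing s b = 0"
proof -
  interpret V: vector_space "\<lambda>c (a :: 'a dpower). const c * a"
    by unfold_locales (simp_all add: distrib_left distrib_right const_add const_mult mult.assoc)
  interpret V1: vector_space "\<lambda>(c :: 'a) a. c * a"
    by unfold_locales (simp_all add: algebra_simps)
  interpret VP: vector_space_pair "\<lambda>c (a :: 'a dpower). const c * a" "\<lambda>(c :: 'a) a. c * a" ..
  have sub: "V.subspace S"
    using S by (auto simp: subspace_def V.subspace_def)
  obtain B where B: "B \<subseteq> S" "V.independent B" "S \<subseteq> V.span B"
    using V.maximal_independent_subset by metis
  have BS: "V.span B = S"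
    using B sub V.span_minimal by blast
  then have vB: "v \<notin> V.span B"
    using v by simp
  have "V.independent (insert v B)"
    using B(2) vB by (simp add: V.independent_insert)
  from VP.linear_independent_extend[OF this, of "\<lambda>x. if x = v then 1 else 0"]
  obtain g where g: "Vector_Spaces.linear (\<lambda>c a. const c * a) (*) g"
      "\<forall>x\<in>insert v B. g x = (if x = v then 1 else 0)"
    by blast
  interpret g: Vector_Spaces.linear "\<lambda>c (a :: 'a dpower). const c * a" "\<lambda>(c :: 'a) a. c * a" g
    by (rule g(1))
  have "v \<notin> B"
    using vB V.span_base by blast
  then have gB: "g x = 0" if "x \<in> B" for x
    using g(2) that by auto
  have g0: "g s = 0" if "s \<in> S" for s
    using VP.linear_eq_0_on_span[OF g(1) gB] that BS by auto
  define b where "b = (\<Sum>\<alpha> | \<alpha> \<le> top_mi. const (g (dmonom \<alpha>)) * dmonom \<alpha>)"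
  have bA: "b \<in> A"
    unfolding b_def by (intro A_sum A_closed(7) A_dmonom) simp
  have "coef b \<alpha> = g (dmonom \<alpha>)" if "\<alpha> \<le> top_mi" for \<alpha>
  proof -
    have "coef b \<alpha> = (\<Sum>\<beta> | \<beta> \<le> top_mi. if \<beta> = \<alpha> then g (dmonom \<alpha>) else 0)"
      unfolding b_def coef_sum by (intro sum.cong) (auto simp: coef_dmonom)
    then show ?thesis
      using that by simp
  qed
  then have pg: "pairing a b = g a" if "a \<in> A" for a
    using arg_cong[OF A_expand[OF that], of g] by (simp add: g.sum g.scale pairing_def)
  show ?thesis
  proof (rule that[OF bA])
    show "pairing v b \<noteq> 0"
      using pg[OF v(1)] g(2) by simp
    show "pairing s b = 0" if "s \<in> S" for s
      using pg g0 that S by (auto simp: subspace_def)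
  qed
qed

lemma choose_top_nonzero: "\<alpha> \<le> top_mi \<Longrightarrow> of_nat (mi_choose top_mi \<alpha>) \<noteq> (0 :: 'a)"
proof -
  assume le: "\<alpha> \<le> top_mi"
  have "mi_choose top_mi \<alpha> = (\<Prod>i\<in>{1..m}. top_mi i choose \<alpha> i)"
    using le by (intro mi_choose_superset) (auto simp: top_mi_def split: if_splits)
  moreover have "of_nat (top_mi i choose \<alpha> i) \<noteq> (0 :: 'a)" if "i \<in> {1..m}" for i
  proof -
    have "\<alpha> i < CHAR('a) ^ n i"
      using le_funD[OF le, of i] that char_pos
      by (metis (full_types) One_nat_def Suc_pred le_imp_less_Suc top_mi_def zero_less_power)
    then show ?thesis
      using of_nat_binomial_prime_power_minus_1[OF char_pos] that by (simp add: top_mi_def)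
  qed
  ultimately show "of_nat (mi_choose top_mi \<alpha>) \<noteq> (0 :: 'a)"
    by simp
qed

lemma mi_top_diff_diff: "\<alpha> \<le> top_mi \<Longrightarrow> top_mi - (top_mi - \<alpha>) = \<alpha>"
  by (auto simp: le_fun_def fun_eq_iff)

lemma mi_top_diff_le: "top_mi - \<alpha> \<le> top_mi"
  by (auto simp: le_fun_def)

lemma coef_top_mult:
  "coef (a * b) top_mi = (\<Sum>\<alpha> | \<alpha> \<le> top_mi. of_nat (mi_choose top_mi \<alpha>) * coef a \<alpha> * coef b (top_mi - \<alpha>))"
  by (simp add: times_dpower.rep_eq dp_prod_def)

text \<open>
  The truncation is a Frobenius algebra: the coefficient at the largest exponent pairs the monomials
  of exponents \<open>\<alpha>\<close> and \<open>top_mi - \<alpha>\<close> to a nonzero value. Thus membership in an ideal can be tested on its annihilator.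
\<close>

lemma top_form_nondegenerate:
  assumes "a \<in> A" "\<And>b. b \<in> A \<Longrightarrow> coef (a * b) top_mi = 0"
  shows "a = 0"
proof (rule dpower_eqI)
  fix \<alpha>
  show "coef a \<alpha> = coef 0 \<alpha>"
  proof (cases "\<alpha> \<le> top_mi")
    case True
    have "top_mi - \<beta> = top_mi - \<alpha> \<longleftrightarrow> \<beta> = \<alpha>" if "\<beta> \<le> top_mi" for \<beta>
      using mi_top_diff_diff True that by metis
    then have "coef (a * dmonom (top_mi - \<alpha>)) top_mi =
        (\<Sum>\<beta> | \<beta> \<le> top_mi. if \<beta> = \<alpha> then of_nat (mi_choose top_mi \<alpha>) * coef a \<alpha> else 0)"
      unfolding coef_top_mult by (intro sum.cong) (auto simp: coef_dmonom mi_top_diff_le)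
    then show ?thesis
      using assms(2)[of "dmonom (top_mi - \<alpha>)"] True choose_top_nonzero[OF True] by (simp add: mi_top_diff_le)
  next
    case False
    then show ?thesis
      using assms(1) by (auto simp: A_iff_le_top)
  qed
qed

lemma top_form_represents_pairing:
  assumes "b \<in> A"
  obtains c where "c \<in> A" "\<And>a. coef (c * a) top_mi = pairing a b"
    "\<And>\<alpha>. \<alpha> \<le> top_mi \<Longrightarrow> coef c (top_mi - \<alpha>) = coef b \<alpha> / of_nat (mi_choose top_mi \<alpha>)"
proof -
  define c where "c = (\<Sum>\<beta> | \<beta> \<le> top_mi. const (coef b \<beta> / of_nat (mi_choose top_mi \<beta>)) * dmonom (top_mi - \<beta>))"
  have c: "coef c (top_mi - \<alpha>) = coef b \<alpha> / of_nat (mi_choose top_mi \<alpha>)" if "\<alpha> \<le> top_mi" for \<alpha>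
  proof -
    have "top_mi - \<alpha> = top_mi - \<beta> \<longleftrightarrow> \<beta> = \<alpha>" if "\<beta> \<le> top_mi" for \<beta>
      using mi_top_diff_diff \<open>\<alpha> \<le> top_mi\<close> that by metis
    then have "coef c (top_mi - \<alpha>) =
        (\<Sum>\<beta> | \<beta> \<le> top_mi. if \<beta> = \<alpha> then coef b \<alpha> / of_nat (mi_choose top_mi \<alpha>) else 0)"
      unfolding c_def coef_sum by (intro sum.cong) (auto simp: coef_dmonom mi_top_diff_le)
    then show ?thesis
      using that by simp
  qed
  show ?thesis
  proof (rule that[OF _ _ c])
    show "c \<in> A"
      by (simp add: c_def mi_top_diff_le)
    show "coef (c * a) top_mi = pairing a b" for a
      unfolding mult.commute[of c] coef_top_mult pairing_def
      by (intro sum.cong) (use choose_top_nonzero in \<open>auto simp: c\<close>)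
  qed
qed

end


section \<open>The core of a derivation\<close>

locale truncation_derivation = truncation m n ty
  for m :: nat and n :: "nat \<Rightarrow> nat" and ty :: "'a::field itself" +
  fixes E :: "'a dpower \<Rightarrow> 'a dpower"
  assumes derivation_E: "derivation E"
    and E_A [simp]: "a \<in> A \<Longrightarrow> E a \<in> A"
begin

text \<open>
  The functionals \<open>ev k\<close> measure how the powers of \<open>E\<close> leave the maximal ideal, which consists of the
  series with constant term \<open>0\<close>. Their common kernel, the core, is the largest \<open>E\<close>-stable subspace of the
  maximal ideal. By the Leibniz formula it is an ideal.
\<close>

definition ev :: "nat \<Rightarrow> 'a dpower \<Rightarrow> 'a" where
  "ev k a = coef ((E ^^ k) a) 0"

definition core :: "'a dpower set" where
  "core = {a \<in> A. \<forall>k. ev k a = 0}"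

lemma ev_linear: "ev k (a + b) = ev k a + ev k b" "ev k (const c * a) = c * ev k a" "ev k 0 = 0"
  "ev k (a - b) = ev k a - ev k b" "ev k (sum g S) = (\<Sum>i\<in>S. ev k (g i))"
  by (simp_all add: ev_def derivation_power_linear[OF derivation_E] coef_sum)

lemma ev_0 [simp]: "ev 0 a = coef a 0"
  by (simp add: ev_def)

lemma ev_Suc: "ev (Suc k) a = ev k (E a)"
  by (simp add: ev_def funpow_Suc_right del: funpow.simps)

lemma ev_mult: "ev k (a * b) = (\<Sum>i\<le>k. of_nat (k choose i) * (ev i a * ev (k - i) b))"
  by (simp add: ev_def derivation_power_mult[OF derivation_E] coef_sum of_nat_dpower)

lemma E_power_A [simp]: "a \<in> A \<Longrightarrow> (E ^^ k) a \<in> A"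
  by (induction k) auto

lemma core_subset: "a \<in> core \<Longrightarrow> a \<in> A"
  by (simp add: core_def)

lemma core_coef_0: "a \<in> core \<Longrightarrow> coef a 0 = 0"
  by (simp add: core_def) (metis ev_0)

lemma core_closed [simp]:
  "0 \<in> core" "a \<in> core \<Longrightarrow> b \<in> core \<Longrightarrow> a + b \<in> core" "a \<in> core \<Longrightarrow> b \<in> core \<Longrightarrow> a - b \<in> core"
  "a \<in> core \<Longrightarrow> b \<in> A \<Longrightarrow> a * b \<in> core" "a \<in> core \<Longrightarrow> b \<in> A \<Longrightarrow> b * a \<in> core"
  "a \<in> core \<Longrightarrow> const c * a \<in> core" "a \<in> core \<Longrightarrow> E a \<in> core"
proof -
  show *: "a \<in> core \<Longrightarrow> b \<in> A \<Longrightarrow> a * b \<in> core" for a b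
    by (simp add: core_def ev_mult)
  then show "a \<in> core \<Longrightarrow> b \<in> A \<Longrightarrow> b * a \<in> core"
    by (simp add: mult.commute)
qed (auto simp: core_def ev_linear ev_Suc[symmetric])

lemma core_sum [simp]: "(\<And>i. i \<in> S \<Longrightarrow> f i \<in> core) \<Longrightarrow> sum f S \<in> core"
  by (induction S rule: infinite_finite_induct) auto

lemma E_power_core [simp]: "a \<in> core \<Longrightarrow> (E ^^ k) a \<in> core"
  by (induction k) auto

text \<open>
  The ideal generated by \<open>S\<close> and the core, used to recognise elements of the core: by maximality of the
  core, it suffices that this ideal is \<open>E\<close>-stable and that \<open>S\<close> lies in the maximal ideal.
\<close>

inductive_set core_plus_ideal :: "'a dpower set \<Rightarrow> 'a dpower set" for S where
  core: "u \<in> core \<Longrightarrow> u \<in> core_plus_ideal S"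
| mult: "s \<in> S \<Longrightarrow> a \<in> A \<Longrightarrow> s * a \<in> core_plus_ideal S"
| add: "a \<in> core_plus_ideal S \<Longrightarrow> b \<in> core_plus_ideal S \<Longrightarrow> a + b \<in> core_plus_ideal S"

lemma core_plus_ideal_mult: "a \<in> core_plus_ideal S \<Longrightarrow> b \<in> A \<Longrightarrow> a * b \<in> core_plus_ideal S"
  by (induction rule: core_plus_ideal.induct)
    (auto simp: distrib_right mult.assoc intro: core_plus_ideal.intros)

lemma core_plus_ideal_sum: "(\<And>i. i \<in> I \<Longrightarrow> f i \<in> core_plus_ideal S) \<Longrightarrow> sum f I \<in> core_plus_ideal S"
  by (induction I rule: infinite_finite_induct) (auto intro: core_plus_ideal.intros)

lemma subset_core:
  assumes S: "\<And>s. s \<in> S \<Longrightarrow> s \<in> A" "\<And>s. s \<in> S \<Longrightarrow> coef s 0 = 0"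
    and E: "\<And>s. s \<in> S \<Longrightarrow> E s \<in> core_plus_ideal S" and s: "s \<in> S"
  shows "s \<in> core"
proof -
  have E': "E a \<in> core_plus_ideal S" if "a \<in> core_plus_ideal S" for a
    using that
  proof (induction rule: core_plus_ideal.induct)
    case (mult s a)
    then show ?case
      by (simp add: derivationD[OF derivation_E] core_plus_ideal.add core_plus_ideal.mult core_plus_ideal_mult E)
  qed (auto simp: derivationD[OF derivation_E] intro: core_plus_ideal.intros)
  have "(E ^^ k) a \<in> core_plus_ideal S" if "a \<in> core_plus_ideal S" for a k
    using that by (induction k) (auto intro: E')
  moreover have "coef a 0 = 0" if "a \<in> core_plus_ideal S" for a
    using that
  proof (induction rule: core_plus_ideal.induct)
    case (mult s a)
    then show ?case by (simp only: coef_mult_0 S mult_zero_left)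
  qed (simp_all only: core_coef_0 coef_simps plus_fun_apply add_0_left)
  moreover have "s \<in> core_plus_ideal S"
    using core_plus_ideal.mult[OF s, of 1] by simp
  ultimately show ?thesis
    using S s by (auto simp: core_def ev_def)
qed

section \<open>Point derivations and polynomials in a derivation\<close>

definition indep :: "nat \<Rightarrow> bool" where
  "indep N \<longleftrightarrow> (\<forall>c. (\<forall>a\<in>A. (\<Sum>j<N. c j * ev j a) = 0) \<longrightarrow> (\<forall>j<N. c j = 0))"

lemma indepD: "indep N \<Longrightarrow> (\<And>a. a \<in> A \<Longrightarrow> (\<Sum>j<N. c j * ev j a) = 0) \<Longrightarrow> j < N \<Longrightarrow> c j = 0"
  unfolding indep_def by metis

definition in_span :: "nat \<Rightarrow> ('a dpower \<Rightarrow> 'a) \<Rightarrow> bool" where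
  "in_span N l \<longleftrightarrow> (\<exists>c. \<forall>a\<in>A. l a = (\<Sum>j<N. c j * ev j a))"

lemma in_span_ev: "j < N \<Longrightarrow> in_span N (ev j)"
  unfolding in_span_def by (rule exI[of _ "\<lambda>i. if i = j then 1 else 0"]) (auto simp: if_distrib[of "\<lambda>x. x * _"] cong: if_cong)

lemma in_span_add:
  assumes "in_span N l" "in_span N l'"
  shows "in_span N (\<lambda>a. l a + l' a)"
proof -
  obtain c c' where "\<forall>a\<in>A. l a = (\<Sum>j<N. c j * ev j a)" "\<forall>a\<in>A. l' a = (\<Sum>j<N. c' j * ev j a)"
    using assms unfolding in_span_def by blast
  then show ?thesis
    unfolding in_span_def by (intro exI[of _ "\<lambda>j. c j + c' j"]) (simp add: distrib_right sum.distrib)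
qed

lemma in_span_scale:
  assumes "in_span N l"
  shows "in_span N (\<lambda>a. x * l a)"
proof -
  obtain c where "\<forall>a\<in>A. l a = (\<Sum>j<N. c j * ev j a)"
    using assms unfolding in_span_def by blast
  then show ?thesis
    unfolding in_span_def by (intro exI[of _ "\<lambda>j. x * c j"]) (simp add: sum_distrib_left mult.assoc)
qed

lemma in_span_0: "in_span N (\<lambda>a. 0)"
  unfolding in_span_def by (intro exI[of _ "\<lambda>_. 0"]) simp

lemma in_span_sum: "(\<And>i. i \<in> I \<Longrightarrow> in_span N (f i)) \<Longrightarrow> in_span N (\<lambda>a. \<Sum>i\<in>I. f i a)"
  by (induction I rule: infinite_finite_induct) (auto intro: in_span_0 in_span_add)

lemma in_span_cong: "(\<And>a. a \<in> A \<Longrightarrow> l a = l' a) \<Longrightarrow> in_span N l \<Longrightarrow> in_span N l'"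
  by (auto simp: in_span_def)

text \<open>
  \<open>ev (Suc k)\<close> is \<open>ev k\<close> composed with \<open>E\<close>, so a linear dependency of \<open>ev t\<close> on its predecessors is
  inherited by all later functionals.
\<close>

lemma in_span_shift:
  assumes t: "in_span t (ev t)"
  shows "in_span t (ev k)"
proof (induction k)
  case 0
  then show ?case
    using t by (cases "t = 0") (simp_all add: in_span_ev del: ev_0)
next
  case (Suc k)
  then obtain c where c: "\<And>a. a \<in> A \<Longrightarrow> ev k a = (\<Sum>j<t. c j * ev j a)"
    unfolding in_span_def by blast
  have "in_span t (ev (Suc j))" if "j < t" for j
    using t that in_span_ev by (cases "Suc j = t") auto
  then have "in_span t (\<lambda>a. \<Sum>j<t. c j * ev (Suc j) a)"
    by (intro in_span_sum in_span_scale) auto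
  then show ?case
    by (rule in_span_cong[rotated]) (simp add: ev_Suc c)
qed

text \<open>
  A representation by the smallest possible number of functionals uses independent ones, since a
  dependency would give a shorter representation.
\<close>

lemma in_span_independent:
  assumes "in_span N l"
  obtains N where "in_span N l" "indep N"
proof -
  define N where "N = (LEAST N. in_span N l)"
  have N: "in_span N l"
    using assms unfolding N_def by (rule LeastI)
  have "indep N"
    unfolding indep_def
  proof (intro allI impI)
    fix c i assume c: "\<forall>a\<in>A. (\<Sum>j<N. c j * ev j a) = 0" and i: "i < N"
    show "c i = 0"
    proof (rule ccontr)
      assume "c i \<noteq> 0"
      \<comment> \<open>the last functional in the dependency\<close>
      define t where "t = Max {j. j < N \<and> c j \<noteq> 0}"
      have t: "t \<in> {j. j < N \<and> c j \<noteq> 0}"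
        unfolding t_def using i \<open>c i \<noteq> 0\<close> by (intro Max_in) auto
      have max: "c j = 0" if "t < j" "j < N" for j
        using that Max_ge[of "{j. j < N \<and> c j \<noteq> 0}" j] unfolding t_def by fastforce
      have "in_span t (ev t)"
        unfolding in_span_def
      proof (intro exI ballI)
        fix a assume "a \<in> A"
        have "0 = (\<Sum>j<N. c j * ev j a)"
          using c \<open>a \<in> A\<close> by simp
        also have "\<dots> = (\<Sum>j<Suc t. c j * ev j a)"
          using t max by (intro sum.mono_neutral_right) (auto simp: not_less less_Suc_eq_le)
        finally have "c t * ev t a = - (\<Sum>j<t. c j * ev j a)"
          by (simp add: add_eq_0_iff2)
        then show "ev t a = (\<Sum>j<t. - (c j / c t) * ev j a)"
          using t by (simp add: sum_negf sum_divide_distrib[symmetric] field_simps)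
      qed
      note tspan = in_span_shift[OF this]
      obtain d where d: "\<forall>a\<in>A. l a = (\<Sum>j<N. d j * ev j a)"
        using N unfolding in_span_def by blast
      have "in_span t (\<lambda>a. \<Sum>j<N. d j * ev j a)"
        by (intro in_span_sum in_span_scale tspan)
      then have "in_span t l"
        by (rule in_span_cong[rotated]) (simp add: d)
      then have "N \<le> t"
        unfolding N_def by (rule Least_le)
      then show False
        using t by simp
    qed
  qed
  then show ?thesis
    using N that by blast
qed

text \<open>
  Duality in finite dimension: the core is the common kernel of the \<open>ev k\<close>, so every functional that
  vanishes on the core is a combination of them.
\<close>

lemma in_span_if_vanishes_on_core:
  assumes \<alpha>: "\<alpha> \<le> top_mi" and core0: "\<And>u. u \<in> core \<Longrightarrow> coef u \<alpha> = 0"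
  obtains N where "in_span N (\<lambda>a. coef a \<alpha>)"
proof -
  \<comment> \<open>the element that represents the functional \<open>ev k\<close>\<close>
  define \<phi> where "\<phi> k = (\<Sum>\<beta> | \<beta> \<le> top_mi. const (ev k (dmonom \<beta>)) * dmonom \<beta>)" for k
  have coef_\<phi>: "coef (\<phi> k) \<beta> = ev k (dmonom \<beta>)" if "\<beta> \<le> top_mi" for k \<beta>
  proof -
    have "coef (\<phi> k) \<beta> = (\<Sum>\<gamma> | \<gamma> \<le> top_mi. if \<gamma> = \<beta> then ev k (dmonom \<beta>) else 0)"
      unfolding \<phi>_def coef_sum by (intro sum.cong) (auto simp: coef_dmonom)
    then show ?thesis
      using that by simp
  qed
  have pair: "pairing (\<phi> k) a = ev k a" if "a \<in> A" for k a
    using arg_cong[OF A_expand[OF that], of "ev k"]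
    by (simp add: ev_linear pairing_def coef_\<phi>) (simp add: mult.commute)
  define S where "S = {(\<Sum>j<N. const (c j) * \<phi> j) | N c. True}"
  have \<phi>A: "\<phi> k \<in> A" for k
    unfolding \<phi>_def by (intro A_sum A_closed(7) A_dmonom) simp
  have SI: "(\<Sum>j<N. const (c j) * \<phi> j) \<in> S" for N c
    unfolding S_def by blast
  have "subspace S"
    unfolding subspace_def
  proof (intro conjI ballI allI)
    show "S \<subseteq> A"
      by (auto simp: S_def \<phi>A)
    have "(\<Sum>j<(0::nat). const (c j) * \<phi> j) \<in> S" for c
      unfolding S_def by blast
    then show "0 \<in> S"
      by simp
  next
    fix a b assume "a \<in> S" "b \<in> S"
    then obtain M c N d where a: "a = (\<Sum>j<M. const (c j) * \<phi> j)" and b: "b = (\<Sum>j<N. const (d j) * \<phi> j)"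
      unfolding S_def by blast
    let ?c = "\<lambda>j. if j < M then c j else 0" and ?d = "\<lambda>j. if j < N then d j else 0"
    have "a = (\<Sum>j<max M N. const (?c j) * \<phi> j)"
      unfolding a by (intro sum.mono_neutral_cong_left) auto
    moreover have "b = (\<Sum>j<max M N. const (?d j) * \<phi> j)"
      unfolding b by (intro sum.mono_neutral_cong_left) auto
    ultimately have "a + b = (\<Sum>j<max M N. const (?c j + ?d j) * \<phi> j)"
      by (simp only: sum.distrib[symmetric] const_add distrib_right)
    then show "a + b \<in> S"
      by (simp only: SI)
  next
    fix x a assume "a \<in> S"
    then obtain M c where a: "a = (\<Sum>j<M. const (c j) * \<phi> j)"
      unfolding S_def by blast
    have "const x * a = (\<Sum>j<M. const (x * c j) * \<phi> j)"
      by (simp add: a sum_distrib_left const_mult mult.assoc)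
    then show "const x * a \<in> S"
      by (simp only: SI)
  qed
  have "dmonom \<alpha> \<in> S"
  proof (rule ccontr)
    assume "dmonom \<alpha> \<notin> S"
    then obtain b where b: "b \<in> A" "pairing (dmonom \<alpha>) b \<noteq> 0" "\<And>s. s \<in> S \<Longrightarrow> pairing s b = 0"
      using separation[OF \<open>subspace S\<close> A_dmonom[OF \<alpha>]] by metis
    have "\<phi> k \<in> S" for k
    proof -
      have *: "\<phi> k = (\<Sum>j<Suc k. const (if j = k then 1 else 0) * \<phi> j)"
        by simp
      show ?thesis
        by (subst *) (rule SI)
    qed
    then have "ev k b = 0" for k
      using b(3)[of "\<phi> k"] pair[OF b(1), of k] by simp
    then have "b \<in> core"
      using b(1) by (simp add: core_def)
    moreover have "pairing (dmonom \<alpha>) b = coef b \<alpha>"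
      unfolding pairing_def using \<alpha> by (simp add: coef_dmonom of_bool_def if_distrib[of "\<lambda>x. x * _"] cong: if_cong)
    ultimately show False
      using b core0 by simp
  qed
  then obtain N c where *: "dmonom \<alpha> = (\<Sum>j<N. const (c j) * \<phi> j)"
    unfolding S_def by blast
  have "coef a \<alpha> = (\<Sum>j<N. c j * ev j a)" if "a \<in> A" for a
  proof -
    have "coef a \<alpha> = pairing (dmonom \<alpha>) a"
      unfolding pairing_def using \<alpha> by (simp add: coef_dmonom of_bool_def if_distrib[of "\<lambda>x. x * _"] cong: if_cong)
    also have "\<dots> = (\<Sum>j<N. c j * pairing (\<phi> j) a)"
      unfolding * pairing_def coef_sum
      by (simp add: sum_distrib_left sum_distrib_right mult.assoc sum.swap[of _ "{..<N}"])
    finally show ?thesis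
      using pair[OF that] by simp
  qed
  then show ?thesis
    using that unfolding in_span_def by blast
qed

definition polyop :: "nat \<Rightarrow> (nat \<Rightarrow> 'a) \<Rightarrow> 'a dpower \<Rightarrow> 'a dpower" where
  "polyop N c a = (\<Sum>j<N. const (c j) * (E ^^ j) a)"

lemma polyop_A [simp]: "a \<in> A \<Longrightarrow> polyop N c a \<in> A"
  by (simp add: polyop_def)

lemma polyop_core [simp]: "a \<in> core \<Longrightarrow> polyop N c a \<in> core"
  by (simp add: polyop_def)

lemma E_power_polyop: "(E ^^ k) (polyop N c a) = polyop N c ((E ^^ k) a)"
proof -
  have "(E ^^ k) ((E ^^ j) a) = (E ^^ j) ((E ^^ k) a)" for j
    by (simp only: comp_apply[symmetric, of "E ^^ k"] comp_apply[symmetric, of "E ^^ _" "E ^^ k"]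
        funpow_add[symmetric] add.commute)
  then show ?thesis
    by (simp add: polyop_def derivation_power_linear[OF derivation_E])
qed

lemma polyop_commute: "polyop N c (polyop M d a) = polyop M d (polyop N c a)"
proof -
  have "polyop N c (polyop M d a) = (\<Sum>i<N. const (c i) * polyop M d ((E ^^ i) a))"
    by (simp add: polyop_def[of N] E_power_polyop)
  also have "\<dots> = polyop M d (polyop N c a)"
    unfolding polyop_def
    by (simp add: derivation_power_linear[OF derivation_E] sum_distrib_left mult_ac sum.swap[of _ "{..<M}"])
  finally show ?thesis .
qed

lemma functional_bilinear_independent:
  assumes "indep N" and c: "\<And>a b. a \<in> A \<Longrightarrow> b \<in> A \<Longrightarrow> (\<Sum>i<N. \<Sum>l<N. c i l * (ev i a * ev l b)) = 0"
    and "i < N" "l < N"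
  shows "c i l = 0"
proof -
  have "(\<Sum>l<N. c i l * ev l b) = 0" if "i < N" "b \<in> A" for i b
  proof -
    have "(\<Sum>i<N. (\<Sum>l<N. c i l * ev l b) * ev i a) = 0" if "a \<in> A" for a
      using c[OF that \<open>b \<in> A\<close>] by (simp add: sum_distrib_left sum_distrib_right mult_ac)
    then show ?thesis
      using indepD[OF assms(1), of "\<lambda>i. \<Sum>l<N. c i l * ev l b"] \<open>i < N\<close> by simp
  qed
  then show ?thesis
    using indepD[OF assms(1), of "c i"] assms(3,4) by simp
qed

text \<open>
  The Leibniz formula says that \<open>ev j\<close> has the coproduct \<open>\<Sum> (j choose i) ev i \<otimes> ev (j - i)\<close>, whereas
  the coefficient at \<open>x\<^sub>i\<close>, a derivation at the origin, is primitive. Comparing coefficients of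
  the independent products \<open>ev k \<otimes> ev l\<close> shows that \<open>\<mu> 0 = 0\<close> and that \<open>\<mu> j\<close> can be nonzero only if all
  the inner binomial coefficients of \<open>j\<close> vanish in the field. For such positive \<open>j\<close> the power \<open>E ^^ j\<close> is a derivation, and so is
  \<open>polyop N \<mu>\<close>.
\<close>

lemma primitive_polyop:
  assumes i: "i \<in> {1..m}" and \<mu>: "\<And>a. a \<in> A \<Longrightarrow> coef a (mi_unit i) = (\<Sum>j<N. \<mu> j * ev j a)"
    and indep: "indep N"
  shows "derivation (polyop N \<mu>)"
proof -
  define \<nu> where "\<nu> j = (if j < N then \<mu> j else 0)" for j
  \<comment> \<open>the coefficient of \<open>ev k \<otimes> ev l\<close> in the difference of the two expressions for the value at \<open>a b\<close>\<close>
  define c where "c k l = \<nu> (k + l) * of_nat (k + l choose k) - (if l = 0 then \<nu> k else 0) -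
      (if k = 0 then \<nu> l else 0)" for k l
  have sum_if: "(\<Sum>l<N. (if l = 0 then x else 0) * f l) = x * f 0" if "N > 0" for x :: 'a and f
    using that by (simp add: if_distrib[of "\<lambda>x. x * _"] cong: if_cong)
  have c0: "c k l = 0" if kl: "k < N" "l < N" for k l
  proof (rule functional_bilinear_independent[OF indep _ kl])
    fix a b assume ab: "a \<in> A" "b \<in> A"
    have "(\<Sum>j<N. \<mu> j * ev j (a * b)) =
        (\<Sum>j<N. \<Sum>k\<le>j. \<mu> j * of_nat (j choose k) * (ev k a * ev (j - k) b))"
      by (simp add: ev_mult sum_distrib_left mult.assoc)
    also have "\<dots> = (\<Sum>(j, k)\<in>(SIGMA j:{..<N}. {..j}). \<mu> j * of_nat (j choose k) * (ev k a * ev (j - k) b))"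
      by (simp add: sum.Sigma)
    also have "\<dots> = (\<Sum>(k, l)\<in>{(k, l). k < N \<and> l < N \<and> k + l < N}.
        \<nu> (k + l) * of_nat (k + l choose k) * (ev k a * ev l b))"
      by (rule sum.reindex_bij_witness[of _ "\<lambda>(k, l). (k + l, k)" "\<lambda>(j, k). (k, j - k)"])
        (auto simp: \<nu>_def)
    also have "\<dots> = (\<Sum>(k, l)\<in>{..<N} \<times> {..<N}. \<nu> (k + l) * of_nat (k + l choose k) * (ev k a * ev l b))"
      by (intro sum.mono_neutral_left) (auto simp: \<nu>_def split: if_splits)
    also have "\<dots> = (\<Sum>k<N. \<Sum>l<N. \<nu> (k + l) * of_nat (k + l choose k) * (ev k a * ev l b))"
      by (simp add: sum.cartesian_product)
    finally have 1: "coef (a * b) (mi_unit i) =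
        (\<Sum>k<N. \<Sum>l<N. \<nu> (k + l) * of_nat (k + l choose k) * (ev k a * ev l b))"
      using \<mu> ab by simp
    have "coef (a * b) (mi_unit i) = coef (deriv i (a * b)) 0"
      by (simp add: coef_deriv)
    also have "\<dots> = coef a (mi_unit i) * coef b 0 + coef a 0 * coef b (mi_unit i)"
      by (simp add: deriv_mult coef_deriv)
    also have "\<dots> = (\<Sum>j<N. \<nu> j * ev j a) * ev 0 b + ev 0 a * (\<Sum>j<N. \<nu> j * ev j b)"
      using \<mu> ab by (simp add: \<nu>_def)
    also have "\<dots> = (\<Sum>k<N. \<Sum>l<N. (if l = 0 then \<nu> k else 0) * (ev k a * ev l b)) +
        (\<Sum>k<N. \<Sum>l<N. (if k = 0 then \<nu> l else 0) * (ev k a * ev l b))"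
    proof -
      have "(\<Sum>k<N. \<Sum>l<N. (if l = 0 then \<nu> k else 0) * (ev k a * ev l b)) = (\<Sum>j<N. \<nu> j * ev j a) * ev 0 b"
        using kl by (simp add: sum_if sum_distrib_right mult.assoc)
      moreover have "(\<Sum>k<N. \<Sum>l<N. (if k = 0 then \<nu> l else 0) * (ev k a * ev l b)) = ev 0 a * (\<Sum>j<N. \<nu> j * ev j b)"
        using kl by (subst sum.swap) (simp add: sum_if, simp add: sum_distrib_left mult_ac)
      ultimately show ?thesis
        by simp
    qed
    finally show "(\<Sum>k<N. \<Sum>l<N. c k l * (ev k a * ev l b)) = 0"
      using 1 by (simp add: c_def left_diff_distrib sum_subtractf)
  qed
  have mid: "\<mu> j * of_nat (j choose k) = 0" if "k \<le> j" "j < N" "k \<noteq> 0" "k \<noteq> j" for j k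
    using c0[of k "j - k"] that by (simp add: c_def \<nu>_def)
  have zero: "\<mu> 0 = 0" if "N > 0"
    using c0[of 0 0] that by (simp add: c_def \<nu>_def)
  show ?thesis
    unfolding derivation_def
  proof (intro conjI allI)
    show "polyop N \<mu> (a + b) = polyop N \<mu> a + polyop N \<mu> b" for a b
      by (simp add: polyop_def derivation_power_linear[OF derivation_E] distrib_left sum.distrib)
    show "polyop N \<mu> (const x) = 0" for x
      unfolding polyop_def
    proof (rule sum.neutral, rule ballI)
      fix j assume "j \<in> {..<N}"
      then show "const (\<mu> j) * (E ^^ j) (const x) = 0"
        using zero by (cases j) (auto simp: funpow_Suc_right derivationD[OF derivation_E]
          derivation_power_linear[OF derivation_E] simp del: funpow.simps(2))
    qed
    show "polyop N \<mu> (a * b) = polyop N \<mu> a * b + a * polyop N \<mu> b" for a b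
    proof -
      have "const (\<mu> j) * (E ^^ j) (a * b) = const (\<mu> j) * (E ^^ j) a * b + a * (const (\<mu> j) * (E ^^ j) b)"
        if j: "j < N" for j
      proof (cases "j = 0")
        case True
        then show ?thesis
          using zero j by simp
      next
        case False
        have "const (\<mu> j) * (E ^^ j) (a * b) =
            (\<Sum>k\<le>j. const (\<mu> j * of_nat (j choose k)) * ((E ^^ k) a * (E ^^ (j - k)) b))"
          by (simp add: derivation_power_mult[OF derivation_E] sum_distrib_left const_mult of_nat_dpower mult.assoc)
        also have "\<dots> = (\<Sum>k\<in>{0, j}. const (\<mu> j * of_nat (j choose k)) * ((E ^^ k) a * (E ^^ (j - k)) b))"
        proof (intro sum.mono_neutral_right ballI)
          fix k assume "k \<in> {..j} - {0, j}"
          then have z: "\<mu> j * of_nat (j choose k) = 0"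
            using mid[of k j] j by blast
          show "const (\<mu> j * of_nat (j choose k)) * ((E ^^ k) a * (E ^^ (j - k)) b) = 0"
            by (simp only: z const_simps mult_zero_left)
        qed auto
        finally show ?thesis
          using False by (simp add: mult_ac)
      qed
      then show ?thesis
        by (simp add: polyop_def sum_distrib_left sum_distrib_right sum.distrib)
    qed
  qed
qed

text \<open>
  Hence a derivation at the origin that kills the core extends to a derivation of the whole algebra
  that commutes with \<open>E\<close>.
\<close>

lemma exists_commuting_derivation:
  assumes i: "i \<in> {1..m}" "mi_unit i \<le> top_mi" and "\<And>u. u \<in> core \<Longrightarrow> coef u (mi_unit i) = 0"
  obtains N \<mu> where "derivation (polyop N \<mu>)" "\<And>a. a \<in> A \<Longrightarrow> coef (polyop N \<mu> a) 0 = coef a (mi_unit i)"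
proof -
  obtain N0 where "in_span N0 (\<lambda>a. coef a (mi_unit i))"
    using in_span_if_vanishes_on_core assms by metis
  then obtain N where N: "in_span N (\<lambda>a. coef a (mi_unit i))" "indep N"
    by (rule in_span_independent)
  then obtain \<mu> where \<mu>: "\<And>a. a \<in> A \<Longrightarrow> coef a (mi_unit i) = (\<Sum>j<N. \<mu> j * ev j a)"
    unfolding in_span_def by blast
  show ?thesis
  proof (rule that[OF primitive_polyop[OF i(1) \<mu> N(2)]])
    show "coef (polyop N \<mu> a) 0 = coef a (mi_unit i)" if "a \<in> A" for a
      using \<mu>[OF that] by (simp add: polyop_def coef_sum ev_def)
  qed auto
qed

end


section \<open>The contact bracket\<close>

locale contact = truncation m n ty
  for m :: nat and n :: "nat \<Rightarrow> nat" and ty :: "'a::field itself" +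
  fixes r :: nat
  assumes m_eq: "m = 2 * r + 1" and r_pos: "r \<ge> 1" and char_gt_3: "CHAR('a) > 3"
    and n_pos: "\<And>i. i \<in> {1..m} \<Longrightarrow> n i > 0"
begin

definition J :: "nat set" where
  "J = {1..2 * r}"

lemma finite_J [simp]: "finite J"
  by (simp add: J_def)

lemma m_notin_J [simp]: "m \<notin> J"
  by (simp add: J_def m_eq)

text \<open>
  Signs are taken as elements of the ring, so that ring normalisation can handle them.
\<close>

definition sg :: "nat \<Rightarrow> 'a dpower" where
  "sg j = const (contact_sign r j)"

abbreviation cj :: "nat \<Rightarrow> nat" where
  "cj \<equiv> conj_index r"

lemma cj [simp]:
  assumes "j \<in> J"
  shows "cj j \<in> J" "cj (cj j) = j" "sg (cj j) = - sg j" "cj j \<noteq> m" "m \<noteq> cj j" "j \<noteq> m"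
proof -
  show 1: "cj j \<in> J"
    using assms by (auto simp: J_def conj_index_def)
  show "cj (cj j) = j" "sg (cj j) = - sg j"
    using assms by (auto simp: J_def conj_index_def sg_def contact_sign_def const_minus)
  show "cj j \<noteq> m" "m \<noteq> cj j" "j \<noteq> m"
    using assms 1 m_notin_J by metis+
qed

lemma sg_sq [simp]: "sg j * sg j = 1" "sg j * (sg j * a) = a"
  by (auto simp: sg_def contact_sign_def const_minus)

lemma sum_conj: "(\<Sum>j\<in>J. F (cj j)) = (\<Sum>j\<in>J. F j)"
  by (rule sum.reindex_bij_witness[of _ cj cj]) auto

lemma deriv_sg [simp]: "deriv k (sg j) = 0"
  by (simp add: sg_def)

definition poisson :: "'a dpower \<Rightarrow> 'a dpower \<Rightarrow> 'a dpower" where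
  "poisson f g = (\<Sum>j\<in>J. sg j * (deriv j f * deriv (cj j) g))"

definition euler :: "'a dpower \<Rightarrow> 'a dpower" where
  "euler f = (\<Sum>j\<in>J. var j * deriv j f)"

text \<open>
  The derivation \<open>D\<^sub>K(f)\<close> in terms of the Poisson bracket and the Euler field of the first \<open>2r\<close>
  variables. In this form, properties of the contact bracket reduce to identities between biderivations.
\<close>

definition D :: "'a dpower \<Rightarrow> 'a dpower \<Rightarrow> 'a dpower" where
  "D f h = poisson f h + deriv m f * euler h + (2 * f - euler f) * deriv m h"

definition bracket :: "'a dpower \<Rightarrow> 'a dpower \<Rightarrow> 'a dpower" where
  "bracket f g = D f g - 2 * g * deriv m f"

lemma poisson_antisym: "poisson f g = - poisson g f"
proof -
  have "poisson f g = (\<Sum>j\<in>J. sg (cj j) * (deriv (cj j) f * deriv (cj (cj j)) g))"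
    unfolding poisson_def by (rule sum_conj[symmetric])
  also have "\<dots> = (\<Sum>j\<in>J. - (sg j * (deriv j g * deriv (cj j) f)))"
    by (intro sum.cong) (auto simp: mult_ac)
  finally show ?thesis
    by (simp add: poisson_def sum_negf)
qed

lemma derivation_poisson: "derivation (poisson f)"
  unfolding derivation_def
  by (simp add: poisson_def deriv_mult sum.distrib sum_distrib_left sum_distrib_right algebra_simps)

lemma derivation_euler: "derivation euler"
  unfolding derivation_def
  by (simp add: euler_def deriv_mult sum.distrib sum_distrib_left sum_distrib_right algebra_simps)

lemma poisson_left: "poisson (a + b) g = poisson a g + poisson b g"
  "poisson (a - b) g = poisson a g - poisson b g"
  "poisson (a * b) g = a * poisson b g + b * poisson a g"
  "poisson (const c) g = 0"
  by (simp_all add: poisson_antisym[of _ g] derivationD[OF derivation_poisson] mult_ac)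

lemma derivation_D: "derivation (D f)"
  unfolding derivation_def
  by (simp add: D_def derivationD[OF derivation_poisson] derivationD[OF derivation_euler] deriv_mult algebra_simps)

lemma deriv_m_poisson: "deriv m (poisson f g) = poisson (deriv m f) g + poisson f (deriv m g)"
  by (simp add: poisson_def deriv_sum deriv_mult sum.distrib distrib_left deriv_commute[of m])

lemma euler_deriv: "k \<in> J \<Longrightarrow> euler (deriv k f) = deriv k (euler f) - deriv k f"
proof -
  assume k: "k \<in> J"
  have "deriv k (euler f) = (\<Sum>j\<in>J. if j = k then deriv j f else 0) + euler (deriv k f)"
    unfolding euler_def deriv_sum sum.distrib[symmetric]
    by (intro sum.cong) (auto simp: deriv_mult deriv_var deriv_commute[of k])
  then show ?thesis
    using k by simp
qed

lemma euler_deriv_m: "euler (deriv m f) = deriv m (euler f)"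
  unfolding euler_def deriv_sum
  by (intro sum.cong) (auto simp: deriv_mult deriv_var deriv_commute[of m])

lemma euler_sg: "euler (sg j) = 0"
  by (simp add: sg_def derivationD[OF derivation_euler])

lemma euler_poisson: "euler (poisson f g) = poisson (euler f) g + poisson f (euler g) - 2 * poisson f g"
proof -
  have "euler (poisson f g) = (\<Sum>j\<in>J. sg j * (deriv j (euler f) * deriv (cj j) g) +
      sg j * (deriv j f * deriv (cj j) (euler g)) - 2 * (sg j * (deriv j f * deriv (cj j) g)))"
    unfolding poisson_def derivationD(9)[OF derivation_euler]
    by (intro sum.cong refl)
      (simp add: derivationD[OF derivation_euler] euler_sg euler_deriv algebra_simps)
  then show ?thesis
    by (simp add: poisson_def sum.distrib sum_subtractf sum_distrib_left)
qed

text \<open>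
  In the nested bracket the terms with second derivatives of \<open>h\<close> are symmetric in \<open>f\<close> and \<open>g\<close>; the
  remaining ones are compared after reindexing by the involution \<open>cj\<close>, which changes the sign.
\<close>

lemma poisson_jacobi: "poisson f (poisson g h) = poisson (poisson f g) h + poisson g (poisson f h)"
proof -
  define T where "T f g = (\<Sum>j\<in>J. \<Sum>k\<in>J. sg j * sg k * (deriv j f * deriv (cj j) (deriv k g) * deriv (cj k) h))" for f g
  define V where "V f g = (\<Sum>j\<in>J. \<Sum>k\<in>J. sg j * sg k * (deriv j f * deriv k g * deriv (cj j) (deriv (cj k) h)))" for f g
  have 1: "poisson f (poisson g h) = T f g + V f g" for f g
    by (simp add: poisson_def T_def V_def deriv_sum deriv_mult sum_distrib_left sum.distrib[symmetric] algebra_simps)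
  have 2: "V f g = V g f"
    unfolding V_def by (subst sum.swap) (simp add: deriv_commute mult_ac)
  have "poisson (poisson f g) h =
      (\<Sum>k\<in>J. \<Sum>j\<in>J. sg k * sg j * (deriv k (deriv j f) * deriv (cj j) g * deriv (cj k) h)) +
      (\<Sum>k\<in>J. \<Sum>j\<in>J. sg j * sg k * (deriv j f * deriv (cj j) (deriv k g) * deriv (cj k) h))"
    unfolding poisson_def sum.distrib[symmetric]
    by (intro sum.cong refl) (simp add: deriv_sum deriv_mult sum_distrib_left sum_distrib_right
        sum.distrib[symmetric] algebra_simps deriv_commute[of _ "cj _"])
  also have "(\<Sum>k\<in>J. \<Sum>j\<in>J. sg j * sg k * (deriv j f * deriv (cj j) (deriv k g) * deriv (cj k) h)) = T f g"
    unfolding T_def by (rule sum.swap)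
  also have "(\<Sum>k\<in>J. \<Sum>j\<in>J. sg k * sg j * (deriv k (deriv j f) * deriv (cj j) g * deriv (cj k) h)) =
      (\<Sum>k\<in>J. \<Sum>j\<in>J. sg k * sg (cj j) * (deriv k (deriv (cj j) f) * deriv (cj (cj j)) g * deriv (cj k) h))"
    by (intro sum.cong refl sum_conj[symmetric])
  also have "\<dots> = - (\<Sum>k\<in>J. \<Sum>j\<in>J. sg j * sg k * (deriv j g * deriv (cj j) (deriv k f) * deriv (cj k) h))"
    unfolding sum_negf[symmetric]
    by (intro sum.cong refl) (simp add: deriv_commute[of _ "cj _"] mult_ac)
  also have "(\<Sum>k\<in>J. \<Sum>j\<in>J. sg j * sg k * (deriv j g * deriv (cj j) (deriv k f) * deriv (cj k) h)) = T g f"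
    unfolding T_def by (rule sum.swap)
  finally show ?thesis
    using 1[of f g] 1[of g f] 2 by simp
qed

text \<open>
  The Leibniz rules, the commutation rules of \<open>\<partial>\<^sub>m\<close> and the Euler field with the Poisson bracket, and the
  Jacobi identity rewrite both sides to the same polynomial.
\<close>

lemma D_bracket: "D (bracket f g) h = D f (D g h) - D g (D f h)"
proof -
  note P = derivationD[OF derivation_poisson]
  note Eu = derivationD[OF derivation_euler]
  have num: "poisson a 2 = 0" "poisson 2 a = 0" "euler 2 = 0" "deriv m 2 = 0" for a
    using P(1)[of a 1 1] poisson_left(1)[of 1 1 a] poisson_left(4)[of 1 a] Eu(1)[of 1 1] deriv_simps(2)[of m 1 1] P(5)[of a] Eu(5)
    by simp_all
  \<comment> \<open>antisymmetry is instantiated because it loops as a rewrite rule\<close>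
  show ?thesis
    using poisson_jacobi[of f g h] poisson_antisym[of g f] poisson_antisym[of g "deriv m f"]
      poisson_antisym[of g "euler f"]
    by (simp add: D_def bracket_def P Eu poisson_left num euler_poisson deriv_m_poisson euler_deriv_m
        deriv_mult algebra_simps)
qed

end


section \<open>Linear terms and the square of an element\<close>

context contact
begin

lemma J_m: "{1..m} = insert m J"
  by (auto simp: J_def m_eq)

lemma J_subset: "j \<in> J \<Longrightarrow> j \<in> {1..m}" "m \<in> {1..m}"
  by (auto simp: J_def m_eq)

lemma mi_unit_le_top: "i \<in> {1..m} \<Longrightarrow> mi_unit i \<le> top_mi"
proof (rule le_funI)
  fix k assume i: "i \<in> {1..m}"
  have "CHAR('a) ^ 1 \<le> CHAR('a) ^ n i"
    using n_pos[OF i] char_gt_3 by (intro power_increasing) auto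
  then show "mi_unit i k \<le> top_mi k"
    using i char_gt_3 by (auto simp: mi_unit_def top_mi_def)
qed

lemma var_A [simp]: "i \<in> {1..m} \<Longrightarrow> var i \<in> A"
  using mi_unit_le_top by (simp add: var_def del: atLeastAtMost_iff)

lemma sg_A [simp]: "sg j \<in> A"
  by (simp add: sg_def)

lemma two_A [simp]: "2 \<in> A"
  using A_closed(4)[OF A_closed(2) A_closed(2)] by simp

lemma euler_A [simp]: "f \<in> A \<Longrightarrow> euler f \<in> A"
  unfolding euler_def by (intro A_sum A_mult var_A J_subset A_closed)

lemma D_A [simp]: "f \<in> A \<Longrightarrow> h \<in> A \<Longrightarrow> D f h \<in> A"
  unfolding D_def poisson_def by (intro A_sum A_mult A_closed sg_A euler_A two_A)

lemma bracket_A [simp]: "f \<in> A \<Longrightarrow> g \<in> A \<Longrightarrow> bracket f g \<in> A"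
  by (simp add: bracket_def)

lemma D_var:
  "j \<in> J \<Longrightarrow> D f (var j) = var j * deriv m f - sg j * deriv (cj j) f"
  "D f (var m) = 2 * f - euler f"
proof -
  have eu: "euler (var k) = (if k \<in> J then var k else 0)" for k
    unfolding euler_def by (simp add: deriv_var if_distrib[of "\<lambda>x. _ * x"] cong: if_cong)
  have po: "poisson f (var k) = (\<Sum>i\<in>J. if cj i = k then sg i * deriv i f else 0)" for k
    unfolding poisson_def by (intro sum.cong) (auto simp: deriv_var)
  {
    assume j: "j \<in> J"
    have "poisson f (var j) = (\<Sum>i\<in>J. if i = cj j then sg (cj j) * deriv (cj j) f else 0)"
      unfolding po by (intro sum.cong) (use j in auto)
    then show "D f (var j) = var j * deriv m f - sg j * deriv (cj j) f"
      using j cj(6)[OF j] cj(6)[OF j, symmetric] by (auto simp: D_def eu deriv_var mult.commute)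
  }
  have "poisson f (var m) = 0"
    unfolding po by (intro sum.neutral) auto
  then show "D f (var m) = 2 * f - euler f"
    by (simp add: D_def eu deriv_var)
qed

text \<open>
  \<open>D f\<close> is a special derivation: it is determined by its values at the variables through the partial
  derivatives, without reference to further divided powers of the variables.
\<close>

lemma D_special: "D f h = (\<Sum>k\<in>{1..m}. deriv k h * D f (var k))"
proof -
  have "(\<Sum>k\<in>J. deriv k h * D f (var k)) =
      (\<Sum>k\<in>J. deriv m f * (var k * deriv k h)) + (\<Sum>k\<in>J. sg (cj k) * (deriv (cj k) f * deriv (cj (cj k)) h))"
    unfolding sum.distrib[symmetric] by (intro sum.cong) (auto simp: D_var algebra_simps)
  also have "(\<Sum>k\<in>J. sg (cj k) * (deriv (cj k) f * deriv (cj (cj k)) h)) = poisson f h"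
    unfolding poisson_def by (rule sum_conj)
  finally show ?thesis
    unfolding J_m
    by (simp add: D_var(2) D_def[of f h]) (simp add: euler_def sum_distrib_left mult.commute)
qed

lemma of_nat_small: "0 < k \<Longrightarrow> k < CHAR('a) \<Longrightarrow> of_nat k \<noteq> (0 :: 'a)"
  by (auto simp: of_nat_eq_0_iff_char_dvd dest: dvd_imp_le)

lemma two_neq_0: "(2 :: 'a) \<noteq> 0"
  using of_nat_small[of 2] char_gt_3 by simp

lemma six_neq_0: "(6 :: 'a) \<noteq> 0"
proof -
  have "(3 :: 'a) \<noteq> 0"
    using of_nat_small[of 3] char_gt_3 by simp
  moreover have "(6 :: 'a) = 2 * 3"
    by simp
  ultimately show ?thesis
    using two_neq_0 by (metis mult_eq_0_iff)
qed

lemma coef_numeral_0 [simp]: "coef (numeral k) 0 = numeral k"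
  by (metis coef_const_0(1) of_nat_dpower of_nat_numeral)

lemma eq_uminus_imp_0:
  fixes a :: "'a dpower"
  assumes "a = - a"
  shows "a = 0"
proof (rule dpower_eqI)
  fix \<alpha>
  have "coef a \<alpha> + coef a \<alpha> = 0"
    using arg_cong[OF assms, of "\<lambda>a. coef a \<alpha>"] by (simp add: eq_neg_iff_add_eq_0)
  then have "2 * coef a \<alpha> = 0"
    by (simp only: mult_2)
  then show "coef a \<alpha> = coef 0 \<alpha>"
    using two_neq_0 by simp
qed

text \<open>
  Applying \<open>d\<close> three times (twice if \<open>c\<close> is a unit) to the product and evaluating at the origin
  distributes one \<open>d\<close> to each factor in the maximal ideal. The value carries the factor \<open>3!\<close> (or \<open>2!\<close>),
  which is nonzero because \<open>p > 3\<close>.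
\<close>

lemma cubic_nonzero:
  fixes c w :: "'a dpower"
  assumes d: "derivation d" and w: "coef w 0 = 0" "coef (d w) 0 \<noteq> 0"
    and c: "coef c 0 \<noteq> 0 \<or> coef (d c) 0 \<noteq> 0"
  shows "c * w * w \<noteq> 0"
proof
  assume 0: "c * w * w = 0"
  note d' = derivationD[OF d]
  show False
  proof (cases "coef c 0 = 0")
    case True
    have "coef (d (d (d (c * w * w)))) 0 = 6 * coef (d c) 0 * coef (d w) 0 * coef (d w) 0"
      using w True by (simp add: d' algebra_simps)
    then show False
      using w c True six_neq_0 by (simp add: 0 d')
  next
    case False
    have "coef (d (d (c * w * w))) 0 = 2 * coef c 0 * coef (d w) 0 * coef (d w) 0"
      using w by (simp add: d' algebra_simps)
    then show False
      using w False two_neq_0 by (simp add: 0 d')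
  qed
qed

text \<open>
  If \<open>c\<close> has no constant term, then one of \<open>\<partial>\<^sub>i\<close>, \<open>\<partial>\<^sub>k\<close> and \<open>\<partial>\<^sub>i + \<partial>\<^sub>k\<close> takes both \<open>c\<close> and \<open>w\<close> to
  series with a nonzero constant term.
\<close>

lemma mult_square_nonzero:
  fixes c w :: "'a dpower"
  assumes "coef w 0 = 0" "coef w (mi_unit i) \<noteq> 0" "coef c (mi_unit k) \<noteq> 0"
  shows "c * w * w \<noteq> 0"
proof -
  have e: "coef (deriv j a) 0 = coef a (mi_unit j)" for j and a :: "'a dpower"
    by (simp add: coef_deriv)
  consider "coef c 0 \<noteq> 0 \<or> coef c (mi_unit i) \<noteq> 0" | "coef w (mi_unit k) \<noteq> 0"
    | "coef c (mi_unit i) = 0" "coef w (mi_unit k) = 0"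
    by blast
  then show ?thesis
  proof cases
    case 1
    then show ?thesis
      using cubic_nonzero[OF derivation_deriv[of i], of w c] assms by (simp add: e)
  next
    case 2
    then show ?thesis
      using cubic_nonzero[OF derivation_deriv[of k], of w c] assms by (simp add: e)
  next
    case 3
    then show ?thesis
      using cubic_nonzero[OF derivation_add[OF derivation_deriv[of i] derivation_deriv[of k]], of w c] assms
      by (simp add: e)
  qed
qed

text \<open>
  The element that admits no partner. It lies one step below the top in the direction of \<open>x\<^sub>m\<close> because
  it is then a derivative with respect to \<open>x\<^sub>m\<close>, and such derivatives are, up to the factor \<open>2\<close>,
  brackets with \<open>1\<close>. The top monomial itself may lie outside the derived algebra.
\<close>

definition sub_top :: "'a dpower" where
  "sub_top = dmonom (top_mi - mi_unit m)"

lemma sub_top_A [simp]: "sub_top \<in> A"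
  by (simp add: sub_top_def mi_top_diff_le)

text \<open>
  If \<open>sub_top\<close> were not a multiple of \<open>w\<^sup>2\<close>, the Frobenius form would give an element \<open>c\<close> that annihilates
  \<open>w\<^sup>2\<close> but not \<open>sub_top\<close>. The latter forces a linear term of \<open>c\<close> in \<open>x\<^sub>m\<close>, and then
  \<open>c w\<^sup>2 \<noteq> 0\<close>.
\<close>

lemma sub_top_in_square:
  assumes w: "w \<in> A" "coef w 0 = 0" "coef w (mi_unit i) \<noteq> 0"
  obtains a where "a \<in> A" "sub_top = w * w * a"
proof -
  define S where "S = {w * w * a | a. a \<in> A}"
  have SI: "w * w * a \<in> S" if "a \<in> A" for a
    using that by (auto simp: S_def)
  have "subspace S"
    unfolding subspace_def
  proof (intro conjI ballI allI)
    show "S \<subseteq> A"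
      using w by (auto simp: S_def)
    show "0 \<in> S"
      using SI[of 0] by simp
    fix a b and c :: 'a assume "a \<in> S" "b \<in> S"
    then obtain a' b' where "a' \<in> A" "a = w * w * a'" "b' \<in> A" "b = w * w * b'"
      unfolding S_def by blast
    then show "a + b \<in> S"
      using SI[of "a' + b'"] by (simp add: distrib_left)
  next
    fix a c assume "a \<in> S"
    then obtain a' where "a' \<in> A" "a = w * w * a'"
      unfolding S_def by blast
    then show "const c * a \<in> S"
      using SI[of "const c * a'"] by (simp add: mult.left_commute)
  qed
  have "sub_top \<in> S"
  proof (rule ccontr)
    assume "sub_top \<notin> S"
    then obtain b where b: "b \<in> A" "pairing sub_top b \<noteq> 0" "\<And>s. s \<in> S \<Longrightarrow> pairing s b = 0"
      using separation[OF \<open>subspace S\<close> sub_top_A] by metis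
    obtain c where c: "c \<in> A" "\<And>a. coef (c * a) top_mi = pairing a b"
      "\<And>\<alpha>. \<alpha> \<le> top_mi \<Longrightarrow> coef c (top_mi - \<alpha>) = coef b \<alpha> / of_nat (mi_choose top_mi \<alpha>)"
      using top_form_represents_pairing[OF b(1)] by metis
    have "c * w * w = 0"
    proof (rule top_form_nondegenerate)
      show "coef (c * w * w * a) top_mi = 0" if "a \<in> A" for a
        using b(3)[OF SI[OF that]] c(2)[of "w * w * a"] by (simp add: mult.assoc)
    qed (use c w in auto)
    moreover have "coef c (mi_unit m) \<noteq> 0"
    proof -
      have "coef b (top_mi - mi_unit m) \<noteq> 0"
      proof
        assume "coef b (top_mi - mi_unit m) = 0"
        then have "pairing sub_top b = 0"
          unfolding pairing_def
          by (intro sum.neutral) (auto simp: sub_top_def coef_dmonom mi_top_diff_le)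
        then show False
          using b by simp
      qed
      then show ?thesis
        using c(3)[OF mi_top_diff_le] mi_top_diff_diff[OF mi_unit_le_top[OF J_subset(2)]]
          choose_top_nonzero[OF mi_top_diff_le] by (metis divide_eq_0_iff)
    qed
    ultimately show False
      using mult_square_nonzero[OF w(2,3)] by blast
  qed
  then show ?thesis
    using that unfolding S_def by blast
qed

end

section \<open>A linear term in the core of a contact derivation\<close>

locale contact_element = contact m n ty r
  for m :: nat and n :: "nat \<Rightarrow> nat" and ty :: "'a::field itself" and r :: nat +
  fixes f :: "'a dpower"
  assumes f_A [simp]: "f \<in> A"
begin

sublocale truncation_derivation m n ty "D f"
  by unfold_locales (auto simp: derivation_D)

lemma D_polyop: "D f (polyop N \<mu> a) = polyop N \<mu> (D f a)"
  using E_power_polyop[of 1] by simp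

lemma coef_var_unit: "coef (var k) (mi_unit i) = of_bool (k = i)"
proof -
  have "mi_unit i = mi_unit k \<longleftrightarrow> k = i"
    by (auto simp: mi_unit_def fun_eq_iff)
  then show ?thesis
    by (simp add: var_def coef_dmonom)
qed

text \<open>
  Write \<open>\<delta> a\<close> for the difference. The choice of \<open>Q = polyop N \<mu>\<close> at the origin gives \<open>\<delta> a\<close> the constant
  term \<open>0\<close>. As \<open>E = D f\<close> is special and commutes with \<open>Q\<close>, one computes
  \<open>E (\<delta> a) = \<Sum> \<delta> (\<partial>\<^sub>k a) E x\<^sub>k\<close>. So the values of \<open>\<delta>\<close> generate an \<open>E\<close>-stable ideal inside the maximal ideal.
\<close>

lemma special_mod_core:
  assumes i: "i \<in> {1..m}" and Q: "derivation (polyop N \<mu>)"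
    "\<And>a. a \<in> A \<Longrightarrow> coef (polyop N \<mu> a) 0 = coef a (mi_unit i)"
    and a: "a \<in> A"
  shows "polyop N \<mu> a - (\<Sum>k\<in>{1..m}. deriv k a * polyop N \<mu> (var k)) \<in> core"
proof -
  let ?Q = "polyop N \<mu>"
  note Q' = derivationD[OF Q(1)] and E' = derivationD[OF derivation_D]
  define \<delta> where "\<delta> a = ?Q a - (\<Sum>k\<in>{1..m}. deriv k a * ?Q (var k))" for a
  have \<delta>A: "\<delta> a \<in> A" if "a \<in> A" for a
    unfolding \<delta>_def using that by (intro A_closed A_sum A_mult polyop_A var_A)
  show ?thesis
    unfolding \<delta>_def[symmetric]
  proof (rule subset_core[of "\<delta> ` A"])
    show "coef s 0 = 0" if "s \<in> \<delta> ` A" for s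
    proof -
      obtain a where a: "s = \<delta> a" "a \<in> A"
        using \<open>s \<in> \<delta> ` A\<close> by blast
      have "coef (\<Sum>k\<in>{1..m}. deriv k a * ?Q (var k)) 0 =
          (\<Sum>k\<in>{1..m}. if k = i then coef a (mi_unit i) else 0)"
        unfolding coef_sum by (intro sum.cong) (auto simp: Q(2) coef_var_unit coef_deriv)
      also have "\<dots> = coef a (mi_unit i)"
        using i by simp
      finally show ?thesis
        using a by (simp add: \<delta>_def Q(2))
    qed
    show "D f s \<in> core_plus_ideal (\<delta> ` A)" if "s \<in> \<delta> ` A" for s
    proof -
      obtain a where a: "s = \<delta> a" "a \<in> A"
        using \<open>s \<in> \<delta> ` A\<close> by blast
      have "D f (?Q a) = (\<Sum>k\<in>{1..m}. ?Q (deriv k a) * D f (var k) + deriv k a * D f (?Q (var k)))"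
        by (simp only: D_polyop) (subst D_special, simp only: Q'(9) Q'(2))
      moreover have "D f (\<Sum>k\<in>{1..m}. deriv k a * ?Q (var k)) =
          (\<Sum>k\<in>{1..m}. D f (deriv k a) * ?Q (var k) + deriv k a * D f (?Q (var k)))"
        by (simp only: E'(9) E'(2))
      moreover have "(\<Sum>k\<in>{1..m}. D f (deriv k a) * ?Q (var k)) =
          (\<Sum>k\<in>{1..m}. (\<Sum>l\<in>{1..m}. deriv l (deriv k a) * ?Q (var l)) * D f (var k))"
      proof -
        have "(\<Sum>k\<in>{1..m}. D f (deriv k a) * ?Q (var k)) =
            (\<Sum>k\<in>{1..m}. \<Sum>l\<in>{1..m}. deriv l (deriv k a) * D f (var l) * ?Q (var k))"
          by (subst D_special) (simp only: sum_distrib_right)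
        also have "\<dots> = (\<Sum>l\<in>{1..m}. \<Sum>k\<in>{1..m}. deriv l (deriv k a) * D f (var l) * ?Q (var k))"
          by (rule sum.swap)
        also have "\<dots> = (\<Sum>k\<in>{1..m}. (\<Sum>l\<in>{1..m}. deriv l (deriv k a) * ?Q (var l)) * D f (var k))"
          unfolding sum_distrib_right by (intro sum.cong refl) (simp add: deriv_commute mult_ac)
        finally show ?thesis .
      qed
      ultimately have "D f s = (\<Sum>k\<in>{1..m}. \<delta> (deriv k a) * D f (var k))"
        by (simp add: a \<delta>_def E' sum.distrib left_diff_distrib sum_subtractf)
      also have "\<dots> \<in> core_plus_ideal (\<delta> ` A)"
        using a by (intro core_plus_ideal_sum core_plus_ideal.mult D_A var_A imageI A_closed f_A)
      finally show ?thesis .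
    qed
  qed (use \<delta>A a in auto)
qed

text \<open>
  The contraction of \<open>Q\<close> with the contact form \<open>dx\<^sub>m + \<Sum> \<sigma>(j) x\<^sub>j dx\<^bsub>cj j\<^esub>\<close>, which takes \<open>D f\<close> to \<open>2 f\<close>.
\<close>

definition contraction :: "('a dpower \<Rightarrow> 'a dpower) \<Rightarrow> 'a dpower" where
  "contraction Q = Q (var m) + (\<Sum>j\<in>J. sg j * (var j * Q (var (cj j))))"

lemma contraction_D: "contraction (D f) = 2 * f"
proof -
  have "(\<Sum>j\<in>J. sg j * (var j * (var (cj j) * deriv m f))) =
      - (\<Sum>j\<in>J. sg j * (var j * (var (cj j) * deriv m f)))" (is "?s = _")
  proof -
    have "?s = (\<Sum>j\<in>J. sg (cj j) * (var (cj j) * (var (cj (cj j)) * deriv m f)))"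
      by (rule sum_conj[symmetric])
    also have "\<dots> = (\<Sum>j\<in>J. - (sg j * (var j * (var (cj j) * deriv m f))))"
      by (intro sum.cong) (auto simp: mult_ac)
    finally show ?thesis
      by (simp add: sum_negf)
  qed
  then have "?s = 0"
    by (rule eq_uminus_imp_0)
  moreover have "(\<Sum>j\<in>J. sg j * (var j * D f (var (cj j)))) = ?s + euler f"
    unfolding euler_def sum.distrib[symmetric]
    by (intro sum.cong) (auto simp: D_var algebra_simps)
  ultimately show ?thesis
    by (simp add: contraction_def D_var)
qed

text \<open>
  A contact derivation multiplies the contact form by a function, here \<open>2 \<partial>\<^sub>m f\<close>. As \<open>Q\<close> commutes with
  \<open>D f\<close> and is special modulo the core, its contraction is multiplied by that function too, modulo the
  core. Its constant term is \<open>0\<close> because \<open>Q\<close> points in the direction \<open>\<partial>\<^sub>i\<close> at the origin, which is not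
  \<open>\<partial>\<^sub>m\<close>. So it generates, together with the core, a stable ideal inside the maximal ideal.
\<close>

lemma contraction_in_core:
  assumes i: "i \<in> J" and Q: "derivation (polyop N \<mu>)"
    "\<And>a. a \<in> A \<Longrightarrow> coef (polyop N \<mu> a) 0 = coef a (mi_unit i)"
  shows "contraction (polyop N \<mu>) \<in> core"
proof -
  let ?Q = "polyop N \<mu>"
  note Q' = derivationD[OF Q(1)] and E' = derivationD[OF derivation_D]
  have Qsg: "?Q (sg j) = 0" and Esg: "D f (sg j) = 0" for j
    by (simp_all only: sg_def Q'(3) E'(3))
  have "D f (contraction ?Q) = ?Q (contraction (D f)) +
      (\<Sum>j\<in>J. sg j * (D f (var j) * ?Q (var (cj j)))) - (\<Sum>j\<in>J. sg j * (?Q (var j) * D f (var (cj j))))"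
    by (simp add: contraction_def E'(1) E'(2) E'(9) Q'(1) Q'(2) Q'(9) Qsg Esg D_polyop distrib_left sum.distrib)
  also have "(\<Sum>j\<in>J. sg j * (?Q (var j) * D f (var (cj j)))) =
      (\<Sum>j\<in>J. sg (cj j) * (?Q (var (cj j)) * D f (var (cj (cj j)))))"
    by (rule sum_conj[symmetric])
  also have "\<dots> = - (\<Sum>j\<in>J. sg j * (D f (var j) * ?Q (var (cj j))))"
    unfolding sum_negf[symmetric] by (intro sum.cong) (auto simp: mult_ac)
  also have "?Q (contraction (D f)) = 2 * ?Q f"
    by (simp only: contraction_D mult_2 Q'(1))
  also have "(\<Sum>j\<in>J. sg j * (D f (var j) * ?Q (var (cj j)))) =
      deriv m f * (\<Sum>j\<in>J. sg j * (var j * ?Q (var (cj j)))) - (\<Sum>j\<in>J. deriv (cj j) f * ?Q (var (cj j)))"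
    unfolding sum_distrib_left sum_subtractf[symmetric]
    by (intro sum.cong) (auto simp: D_var algebra_simps)
  also have "(\<Sum>j\<in>J. deriv (cj j) f * ?Q (var (cj j))) = (\<Sum>j\<in>J. deriv j f * ?Q (var j))"
    by (rule sum_conj)
  finally have E\<alpha>: "D f (contraction ?Q) =
      2 * (?Q f - (\<Sum>k\<in>{1..m}. deriv k f * ?Q (var k))) + contraction ?Q * (2 * deriv m f)"
    unfolding J_m by (simp add: contraction_def algebra_simps)
  have \<alpha>A: "contraction ?Q \<in> A"
    unfolding contraction_def using J_subset cj(1) by (intro A_closed A_sum A_mult polyop_A var_A sg_A) auto
  show ?thesis
  proof (rule subset_core[of "{contraction ?Q}"])
    have "coef (contraction ?Q) 0 = coef (?Q (var m)) 0"
      by (simp add: contraction_def coef_sum)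
    also have "\<dots> = 0"
      using Q(2)[OF var_A[OF J_subset(2)]] cj(6)[OF i] cj(6)[OF i, symmetric] by (auto simp: coef_var_unit)
    finally show "coef s 0 = 0" if "s \<in> {contraction ?Q}" for s
      using that by simp
    show "D f s \<in> core_plus_ideal {contraction ?Q}" if "s \<in> {contraction ?Q}" for s
    proof -
      have "2 * (?Q f - (\<Sum>k\<in>{1..m}. deriv k f * ?Q (var k))) \<in> core"
        using special_mod_core[OF J_subset(1)[OF i] Q f_A] by (intro core_closed(5) two_A)
      moreover have "contraction ?Q * (2 * deriv m f) \<in> core_plus_ideal {contraction ?Q}"
        by (intro core_plus_ideal.mult A_mult) auto
      ultimately show ?thesis
        using that by (simp only: singleton_iff E\<alpha>) (intro core_plus_ideal.add[OF core_plus_ideal.core])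
    qed
  qed (use \<alpha>A in auto)
qed

text \<open>
  Otherwise there are commuting derivations \<open>Q\<close> and \<open>Q'\<close> that point in the directions \<open>\<partial>\<^sub>1\<close> and
  \<open>\<partial>\<^bsub>1 + r\<^esub>\<close> at the origin and whose contractions with the contact form lie in the core. Then the
  differential of the contact form vanishes on the pair \<open>Q\<close>, \<open>Q'\<close> at the origin. But that differential is
  nondegenerate on the kernel of \<open>dx\<^sub>m\<close> there, and its value on this pair is \<open>2\<close> up to sign.
\<close>

lemma exists_linear_part_in_core:
  obtains w i where "w \<in> core" "coef w (mi_unit i) \<noteq> 0"
proof (rule ccontr)
  assume "\<not> thesis"
  with that have no: "coef w (mi_unit i) = 0" if "w \<in> core" for w i
    using \<open>w \<in> core\<close> by blast
  have J1: "1 \<in> J" "1 + r \<in> J" and cj1: "cj 1 = 1 + r" "cj (1 + r) = 1"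
    using r_pos by (auto simp: J_def conj_index_def)
  have sg1: "coef (sg 1) 0 = 1" "coef (sg (1 + r)) 0 = - 1"
    using r_pos by (auto simp: sg_def contact_sign_def)
  have le: "mi_unit i \<le> top_mi" if "i \<in> J" for i
    using mi_unit_le_top J_subset that by blast
  obtain N \<mu> where Q: "derivation (polyop N \<mu>)" "\<And>a. a \<in> A \<Longrightarrow> coef (polyop N \<mu> a) 0 = coef a (mi_unit 1)"
    using exists_commuting_derivation[of 1] J_subset(1)[OF J1(1)] le[OF J1(1)] no by metis
  obtain N' \<mu>' where Q': "derivation (polyop N' \<mu>')" "\<And>a. a \<in> A \<Longrightarrow> coef (polyop N' \<mu>' a) 0 = coef a (mi_unit (1 + r))"
    using exists_commuting_derivation[of "1 + r"] J_subset(1)[OF J1(2)] le[OF J1(2)] no by metis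
  let ?Q = "polyop N \<mu>" and ?Q' = "polyop N' \<mu>'"
  have cQ: "contraction ?Q \<in> core" and cQ': "contraction ?Q' \<in> core"
    using contraction_in_core J1 Q Q' by blast+
  have "coef (?Q' (contraction ?Q) - ?Q (contraction ?Q')) 0 = 0"
    using cQ cQ' by (intro core_coef_0 core_closed polyop_core)
  moreover have "?Q' (contraction ?Q) - ?Q (contraction ?Q') =
      (\<Sum>j\<in>J. sg j * (?Q' (var j) * ?Q (var (cj j)) - ?Q (var j) * ?Q' (var (cj j))))"
  proof -
    have "?Q (sg j) = 0" "?Q' (sg j) = 0" for j
      by (simp_all only: sg_def derivationD(3)[OF Q(1)] derivationD(3)[OF Q'(1)])
    then show ?thesis
      by (simp add: contraction_def derivationD(1,2,9)[OF Q(1)] derivationD(1,2,9)[OF Q'(1)]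
          polyop_commute[of N' \<mu>' N \<mu>] sum_subtractf[symmetric] right_diff_distrib distrib_left)
  qed
  moreover have "coef (\<Sum>j\<in>J. sg j * (?Q' (var j) * ?Q (var (cj j)) - ?Q (var j) * ?Q' (var (cj j)))) 0 =
      (\<Sum>j\<in>J. (if j = 1 + r then - 1 else 0) - (if j = 1 then 1 else 0))"
    unfolding coef_sum
  proof (intro sum.cong refl)
    fix j assume j: "j \<in> J"
    have v: "var j \<in> A" "var (cj j) \<in> A"
      by (rule var_A[OF J_subset(1)[OF j]], rule var_A[OF J_subset(1)[OF cj(1)[OF j]]])
    have eq: "cj j = 1 \<longleftrightarrow> j = 1 + r" "cj j = 1 + r \<longleftrightarrow> j = 1"
      using cj1 cj(2)[OF j] by auto
    have "coef (sg j * (?Q' (var j) * ?Q (var (cj j)) - ?Q (var j) * ?Q' (var (cj j)))) 0 =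
        coef (sg j) 0 * (of_bool (j = 1 + r) - of_bool (j = 1))"
      unfolding coef_mult_0 coef_simps minus_apply Q(2)[OF v(1)] Q(2)[OF v(2)] Q'(2)[OF v(1)] Q'(2)[OF v(2)]
        coef_var_unit eq using r_pos by auto
    then show "coef (sg j * (?Q' (var j) * ?Q (var (cj j)) - ?Q (var j) * ?Q' (var (cj j)))) 0 =
        (if j = 1 + r then - 1 else 0) - (if j = 1 then 1 else 0)"
      using sg1 r_pos by (cases "j = 1"; cases "j = 1 + r") simp_all
  qed
  moreover have "\<dots> = - 2"
    using J1 by (simp add: sum_subtractf)
  ultimately show False
    using two_neq_0 by simp
qed

section \<open>The square of the core\<close>

inductive_set core_square :: "'a dpower set" where
  mult: "u \<in> core \<Longrightarrow> v \<in> core \<Longrightarrow> u * v \<in> core_square"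
| add: "a \<in> core_square \<Longrightarrow> b \<in> core_square \<Longrightarrow> a + b \<in> core_square"

lemma core_square_0: "0 \<in> core_square"
  using core_square.mult[OF core_closed(1) core_closed(1)] by simp

lemma core_square_subset: "a \<in> core_square \<Longrightarrow> a \<in> core"
  by (induction rule: core_square.induct) (auto intro: core_closed(4)[OF _ core_subset])

lemma core_square_mult: "a \<in> core_square \<Longrightarrow> b \<in> A \<Longrightarrow> a * b \<in> core_square"
  by (induction rule: core_square.induct) (auto simp: mult.assoc distrib_right intro!: core_square.intros)

lemma core_square_const: "a \<in> core_square \<Longrightarrow> const c * a \<in> core_square"
  using core_square_mult[of a "const c"] by (simp add: mult.commute)

lemma core_square_diff: "a \<in> core_square \<Longrightarrow> b \<in> core_square \<Longrightarrow> a - b \<in> core_square"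
  using core_square.add[of a "const (- 1) * b"] core_square_const[of b "- 1"] by (simp add: const_minus)

lemma core_square_sum: "(\<And>i. i \<in> S \<Longrightarrow> g i \<in> core_square) \<Longrightarrow> sum g S \<in> core_square"
  by (induction S rule: infinite_finite_induct) (auto intro: core_square.intros core_square_0)

lemma core_square_D: "a \<in> core_square \<Longrightarrow> D f a \<in> core_square"
  by (induction rule: core_square.induct) (auto simp: derivationD[OF derivation_D] intro!: core_square.intros core_closed)

lemma core_square_deriv: "a \<in> core_square \<Longrightarrow> deriv k a \<in> core"
  by (induction rule: core_square.induct) (auto simp: deriv_mult core_subset)

lemma core_square_coef_0: "a \<in> core_square \<Longrightarrow> coef a 0 = 0"
  using core_square_subset core_coef_0 by blast

lemma core_square_coef_unit: "a \<in> core_square \<Longrightarrow> coef a (mi_unit k) = 0"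
  using core_coef_0[OF core_square_deriv[of a k]] by (simp add: coef_deriv)

text \<open>
  Each term of the bracket has one derivative of order at most one on either argument, and such a
  derivative takes the square of the core into the core.
\<close>

lemma bracket_core_square:
  assumes "g \<in> core_square" "h \<in> core_square"
  shows "bracket g h \<in> core_square"
proof -
  have eu: "euler a \<in> core" if "a \<in> core_square" for a
    unfolding euler_def using that J_subset by (intro core_sum core_closed(5) core_square_deriv var_A) auto
  have "poisson g h \<in> core_square"
    unfolding poisson_def mult.assoc[symmetric]
    using assms by (intro core_square_sum core_square.mult core_closed core_square_deriv sg_A)
  moreover have "deriv m g * euler h \<in> core_square" "(2 * g - euler g) * deriv m h \<in> core_square" "2 * h * deriv m g \<in> core_square"
    using core_square.mult[OF core_square_deriv eu] core_square.mult[OF core_closed(3)[OF core_closed(5)[OF core_square_subset two_A] eu] core_square_deriv]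
      core_square.mult[OF core_closed(5)[OF core_square_subset two_A] core_square_deriv] assms by blast+
  ultimately show ?thesis
    unfolding bracket_def D_def by (intro core_square.add core_square_diff)
qed

lemma bracket_f_core_square: "g \<in> core_square \<Longrightarrow> bracket f g \<in> core_square"
  unfolding bracket_def
  by (intro core_square_diff core_square_D) (auto simp: mult.assoc mult.left_commute[of 2] intro!: core_square_mult)

lemma sub_top_core_square: "sub_top \<in> core_square"
proof -
  obtain w i where w: "w \<in> core" "coef w (mi_unit i) \<noteq> 0"
    by (rule exists_linear_part_in_core)
  obtain a where "a \<in> A" "sub_top = w * w * a"
    using sub_top_in_square[OF core_subset[OF w(1)] core_coef_0[OF w(1)] w(2)] .
  then show ?thesis
    using w by (auto intro: core_square_mult core_square.mult)
qed

end


section \<open>Contact operators\<close>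

context contact
begin

text \<open>
  For truncated series, both products have nonzero terms only at exponents supported in \<open>{1..m}\<close>,
  where the two multinomial coefficients agree.
\<close>

lemma dp_mult_coef:
  assumes "f \<in> A" "g \<in> A"
  shows "dp_mult m (coef f) (coef g) = coef (f * g)"
proof
  fix \<gamma>
  show "dp_mult m (coef f) (coef g) \<gamma> = coef (f * g) \<gamma>"
    unfolding dp_mult_def times_dpower.rep_eq dp_prod_def
  proof (rule sum.cong[OF refl])
    fix \<alpha> assume "\<alpha> \<in> {\<alpha>. \<alpha> \<le> \<gamma>}"
    then have le: "\<alpha> \<le> \<gamma>"
      by simp
    show "of_nat (mi_binom m \<gamma> \<alpha>) * coef f \<alpha> * coef g (\<gamma> - \<alpha>) =
        of_nat (mi_choose \<gamma> \<alpha>) * coef f \<alpha> * coef g (\<gamma> - \<alpha>)"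
    proof (cases "coef f \<alpha> = 0 \<or> coef g (\<gamma> - \<alpha>) = 0")
      case False
      then have "\<alpha> \<le> top_mi" "\<gamma> - \<alpha> \<le> top_mi"
        using assms by (auto simp: A_iff_le_top)
      then have "\<gamma> i = 0" if "i \<notin> {1..m}" for i
        using that le_funD[of \<alpha> top_mi i] le_funD[of "\<gamma> - \<alpha>" top_mi i]
        by (simp add: top_mi_def del: atLeastAtMost_iff)
      then have "{i. \<gamma> i \<noteq> 0} \<subseteq> {1..m}"
        by (intro subsetI) (metis mem_Collect_eq)
      from mi_choose_superset[OF finite_atLeastAtMost this le] show ?thesis
        by (simp add: mi_binom_def)
    qed auto
  qed
qed

lemma dp_deriv_coef: "dp_deriv k (coef f) = coef (deriv k f)"
  by (simp add: deriv.rep_eq)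

lemma dp_scale_coef: "dp_scale c (coef f) = coef (const c * f)"
  by (simp add: dp_scale_def fun_eq_iff)

lemma dp_var_coef: "dp_var k = coef (var k)"
  by (simp add: dp_var_def var_def dmonom.rep_eq)

lemma dp_alg_coef: "h \<in> dp_alg m n \<Longrightarrow> \<exists>g\<in>A. h = coef g"
proof -
  assume h: "h \<in> dp_alg m n"
  have "h \<alpha> = 0" if "\<not> finite_mi \<alpha>" for \<alpha>
  proof (rule ccontr)
    assume "h \<alpha> \<noteq> 0"
    then have "\<forall>i. i \<notin> {1..m} \<longrightarrow> \<alpha> i = 0"
      using h by (simp add: dp_alg_def del: atLeastAtMost_iff)
    then have "{i. \<alpha> i \<noteq> 0} \<subseteq> {1..m}"
      by (intro subsetI) (metis mem_Collect_eq)
    then show False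
      using that finite_subset by (auto simp: finite_mi_def)
  qed
  then have "coef (Abs_dpower h) = h"
    by (intro Abs_dpower_inverse) simp
  then show ?thesis
    using h by (intro bexI[of _ "Abs_dpower h"]) (auto simp: A_def)
qed

definition contact_op :: "'a dpower \<Rightarrow> 'a dp_op" where
  "contact_op f = D_K r n (coef f)"

lemma contact_op_coef:
  assumes f: "f \<in> A" and h: "h \<in> A"
  shows "contact_op f (coef h) = coef (D f h)"
proof -
  define C where "C k = (if k = m then dp_scale 2 (coef f) - (\<Sum>j=1..2*r. dp_mult m (dp_var j) (dp_deriv j (coef f)))
       else dp_scale (contact_sign r (cj k)) (dp_deriv (cj k) (coef f)) + dp_mult m (dp_var k) (dp_deriv m (coef f)))" for k
  have C: "C k = coef (D f (var k))" if "k \<in> {1..m}" for k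
  proof (cases "k = m")
    case True
    have "(\<Sum>j=1..2*r. dp_mult m (dp_var j) (dp_deriv j (coef f))) = (\<Sum>j\<in>J. coef (var j * deriv j f))"
      unfolding J_def[symmetric]
      by (intro sum.cong refl) (simp only: dp_var_coef dp_deriv_coef dp_mult_coef var_A J_subset f A_closed)
    then show ?thesis
      using True by (simp add: C_def dp_scale_coef D_var euler_def coef_sum_fun)
  next
    case False
    then have k: "k \<in> J"
      using that unfolding J_m by simp
    have "const (contact_sign r (cj k)) = sg (cj k)"
      by (simp add: sg_def)
    then show ?thesis
      using False k that f
      by (simp add: C_def dp_scale_coef dp_var_coef dp_deriv_coef dp_mult_coef D_var del: atLeastAtMost_iff)
  qed
  have "contact_op f = special_derivation m n C"
    unfolding contact_op_def D_K_def Let_def m_eq[symmetric] C_def by (rule refl)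
  then have "contact_op f (coef h) = (\<Sum>k=1..m. dp_mult m (C k) (dp_deriv k (coef h)))"
    using h by (simp add: special_derivation_def A_def)
  also have "\<dots> = (\<Sum>k=1..m. coef (deriv k h * D f (var k)))"
    using f h by (intro sum.cong refl)
      (simp only: C dp_deriv_coef, subst dp_mult_coef, simp_all add: mult.commute del: atLeastAtMost_iff)
  also have "\<dots> = coef (D f h)"
    by (subst D_special) (rule coef_sum_fun[symmetric])
  finally show ?thesis .
qed

lemma contact_op_outside: "h \<notin> dp_alg m n \<Longrightarrow> contact_op f h = 0"
  unfolding contact_op_def D_K_def Let_def m_eq[symmetric] special_derivation_def by simp

lemma contact_op_eqI:
  assumes "\<And>h. h \<in> A \<Longrightarrow> F (coef h) = G (coef h)" "\<And>h. h \<notin> dp_alg m n \<Longrightarrow> F h = G h"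
  shows "F = G"
  using assms dp_alg_coef by (intro ext) blast

lemma D_left: "D (f + g) h = D f h + D g h" "D (const c * f) h = const c * D f h"
proof -
  have "poisson (const c * f) h = const c * poisson f h"
    by (simp add: poisson_left)
  then show "D (const c * f) h = const c * D f h"
    unfolding D_def by (simp add: deriv_mult derivationD[OF derivation_euler]) (simp add: algebra_simps)
  show "D (f + g) h = D f h + D g h"
    by (simp add: D_def poisson_left derivationD[OF derivation_euler] algebra_simps)
qed

lemma contact_op_add: "f \<in> A \<Longrightarrow> g \<in> A \<Longrightarrow> contact_op (f + g) = contact_op f + contact_op g"
  by (rule contact_op_eqI) (auto simp: contact_op_coef contact_op_outside D_left)

lemma contact_op_scale: "f \<in> A \<Longrightarrow> contact_op (const c * f) = op_scale c (contact_op f)"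
  by (rule contact_op_eqI) (auto simp: contact_op_coef contact_op_outside D_left op_scale_def dp_scale_coef dp_scale_def)

lemma contact_op_bracket:
  assumes "f \<in> A" "g \<in> A"
  shows "op_bracket (contact_op f) (contact_op g) = contact_op (bracket f g)"
proof (rule contact_op_eqI)
  fix h assume "h \<in> A"
  then show "op_bracket (contact_op f) (contact_op g) (coef h) = contact_op (bracket f g) (coef h)"
    using assms by (simp add: op_bracket_def contact_op_coef D_bracket)
next
  have "contact_op f 0 = 0" if "f \<in> A" for f
    using contact_op_coef[OF that A_closed(1)] by (simp add: derivationD[OF derivation_D])
  then show "op_bracket (contact_op f) (contact_op g) h = contact_op (bracket f g) h" if "h \<notin> dp_alg m n" for h
    using that assms by (simp add: op_bracket_def contact_op_outside)
qed

abbreviation K :: "'a dp_op set" where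
  "K \<equiv> contact_algebra r n"

abbreviation L :: "'a dp_op set" where
  "L \<equiv> contact_algebra_derived r n"

lemma K_eq: "K = contact_op ` A"
  unfolding contact_algebra_def m_eq[symmetric] contact_op_def A_def using dp_alg_coef by (force simp: A_def)

lemma K_subspace: "op.subspace K"
  unfolding K_eq
proof (rule op.subspaceI)
  have "contact_op 0 = 0"
    using contact_op_scale[of 0 0] by (simp add: op_scale_def dp_scale_def fun_eq_iff)
  then show "0 \<in> contact_op ` A"
    by (metis A_closed(1) imageI)
  show "F + G \<in> contact_op ` A" if "F \<in> contact_op ` A" "G \<in> contact_op ` A" for F G
    using that by (auto simp: contact_op_add[symmetric])
  show "op_scale c F \<in> contact_op ` A" if "F \<in> contact_op ` A" for c F
    using that by (auto simp: contact_op_scale[symmetric])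
qed

lemma L_eq: "L = op.span {op_bracket F G | F G. F \<in> K \<and> G \<in> K}"
  by (simp add: contact_algebra_derived_def derived_subalgebra_def)

lemma bracket_K: "F \<in> K \<Longrightarrow> G \<in> K \<Longrightarrow> op_bracket F G \<in> K"
  unfolding K_eq by (auto simp: contact_op_bracket)

lemma L_subset_K: "L \<subseteq> K"
  unfolding L_eq by (rule op.span_minimal[OF _ K_subspace]) (auto intro: bracket_K)

lemma bracket_K_L: "F \<in> K \<Longrightarrow> G \<in> K \<Longrightarrow> op_bracket F G \<in> L"
  unfolding L_eq by (rule op.span_base) blast

lemma deriv_m_in_L:
  assumes "g \<in> A"
  shows "contact_op (deriv m g) \<in> L"
proof -
  have "bracket 1 g = 2 * deriv m g"
  proof -
    have "poisson 1 g = 0"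
      using poisson_left(4)[of 1 g] by simp
    then show ?thesis
      by (simp add: bracket_def D_def derivationD[OF derivation_euler])
  qed
  then have "op_bracket (contact_op 1) (contact_op g) = op_scale 2 (contact_op (deriv m g))"
    using contact_op_bracket[of 1 g] contact_op_scale[of "deriv m g" 2] assms by simp
  moreover have "op_bracket (contact_op 1) (contact_op g) \<in> L"
    using assms by (intro bracket_K_L) (auto simp: K_eq)
  ultimately have "op_scale (1 / 2) (op_scale 2 (contact_op (deriv m g))) \<in> L"
    unfolding L_eq by (simp only: op.span_scale)
  then show ?thesis
    using two_neq_0 by simp
qed

lemma sub_top_eq: "sub_top = deriv m (dmonom top_mi)"
proof -
  have "top_mi m \<noteq> 0"
    using le_funD[OF mi_unit_le_top[OF J_subset(2)], of m] by (simp add: mi_unit_def)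
  then show ?thesis
    by (simp add: sub_top_def deriv_dmonom)
qed

lemma bracket_linear:
  "bracket (f + g) h = bracket f h + bracket g h" "bracket f (g + h) = bracket f g + bracket f h"
  "bracket (const c * f) h = const c * bracket f h" "bracket f (const c * h) = const c * bracket f h"
  by (simp_all add: bracket_def D_left derivationD[OF derivation_D] deriv_mult)
    (simp_all add: algebra_simps)

lemma bracket_antisym: "bracket f g = - bracket g f"
  using poisson_antisym[of f g] by (simp add: bracket_def D_def algebra_simps)

lemma bracket_self: "bracket f f = 0"
  by (rule eq_uminus_imp_0) (rule bracket_antisym)

lemma sub_top_in_L: "contact_op sub_top \<in> L"
  using deriv_m_in_L[of "dmonom top_mi"] by (simp add: sub_top_eq)

lemma sub_top_nonzero: "contact_op sub_top \<noteq> 0"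
proof
  interpret X: contact_element m n ty r sub_top
    by unfold_locales simp
  assume "contact_op sub_top = 0"
  then have "D sub_top (var k) = 0" if "k \<in> {1..m}" for k
    using contact_op_coef[OF sub_top_A var_A[OF that]] by (metis coef_inject zero_dpower.rep_eq zero_fun_apply)
  then have "X.contraction (D sub_top) = 0"
    unfolding X.contraction_def using J_subset cj(1) by (simp add: sum.neutral del: atLeastAtMost_iff)
  then have "2 * sub_top = 0"
    by (simp add: X.contraction_D)
  then have "2 * coef sub_top (top_mi - mi_unit m) = 0"
    using coef_const_mult[of 2 sub_top] by simp
  then show False
    using two_neq_0 by (simp add: sub_top_def coef_dmonom mi_top_diff_le)
qed

end

section \<open>Generated subalgebras\<close>

context contact_element
begin

text \<open>
  The upper bound for the subalgebra generated by \<open>sub_top\<close> and \<open>f\<close>.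
\<close>

definition M :: "'a dpower set" where
  "M = {const c * f + g | c g. g \<in> core_square}"

lemma M_I: "g \<in> core_square \<Longrightarrow> const c * f + g \<in> M"
  by (auto simp: M_def)

lemma M_A: "a \<in> M \<Longrightarrow> a \<in> A"
  unfolding M_def by (auto intro!: A_closed(4) A_closed(7) f_A intro: core_subset[OF core_square_subset])

lemma bracket_M:
  assumes "a \<in> M" "b \<in> M"
  shows "bracket a b \<in> M"
proof -
  obtain c g d h where a: "a = const c * f + g" "g \<in> core_square" and b: "b = const d * f + h" "h \<in> core_square"
    using assms unfolding M_def by blast
  have "bracket a b = const c * bracket f h - const d * bracket f g + bracket g h"
    unfolding a b bracket_linear bracket_self bracket_antisym[of g f] by simp
  also have "\<dots> \<in> core_square"
    using a b by (intro core_square.add core_square_diff core_square_const bracket_f_core_square bracket_core_square)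
  finally show ?thesis
    using M_I[of _ 0] by simp
qed

lemma generated_subset: "lie_generated op_scale op_bracket L {contact_op sub_top, contact_op f} \<subseteq> L \<inter> contact_op ` M"
  if f: "contact_op f \<in> L"
  unfolding lie_generated_def
proof (rule hull_minimal)
  show "{contact_op sub_top, contact_op f} \<subseteq> L \<inter> contact_op ` M"
    using f sub_top_in_L M_I[OF sub_top_core_square, of 0] M_I[OF core_square_0, of 1] by auto
  show "lie_subalgebra op_scale op_bracket L (L \<inter> contact_op ` M)"
    unfolding lie_subalgebra_def
  proof (intro conjI ballI)
    have "op.subspace (contact_op ` M)"
    proof (rule op.subspaceI)
      show "0 \<in> contact_op ` M"
      proof -
        have "contact_op 0 = 0"
          using contact_op_scale[of 0 0] by (simp add: op_scale_def dp_scale_def fun_eq_iff)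
        then show ?thesis
          using M_I[OF core_square_0, of 0] by (metis add_0 const_simps(1) imageI mult_zero_left)
      qed
    next
      fix F G assume "F \<in> contact_op ` M" "G \<in> contact_op ` M"
      then obtain a b where ab: "a \<in> M" "F = contact_op a" "b \<in> M" "G = contact_op b"
        by blast
      then obtain c g d h where "a = const c * f + g" "g \<in> core_square" "b = const d * f + h" "h \<in> core_square"
        unfolding M_def by blast
      then have "a + b \<in> M"
        using M_I[OF core_square.add[of g h], of "c + d"] by (simp add: const_add algebra_simps)
      then show "F + G \<in> contact_op ` M"
        using ab M_A contact_op_add by (metis imageI)
    next
      fix x F assume "F \<in> contact_op ` M"
      then obtain a where a: "a \<in> M" "F = contact_op a"
        by blast
      then obtain c g where "a = const c * f + g" "g \<in> core_square"
        unfolding M_def by blast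
      then have "const x * a \<in> M"
        using M_I[OF core_square_const[of g x], of "x * c"] by (simp add: const_mult algebra_simps)
      then show "op_scale x F \<in> contact_op ` M"
        using a M_A contact_op_scale by (metis imageI)
    qed
    moreover have "op.subspace L"
      unfolding L_eq by (rule op.subspace_span)
    ultimately show "op.subspace (L \<inter> contact_op ` M)"
      by (intro op.subspace_inter)
  next
    fix F G assume FG: "F \<in> L \<inter> contact_op ` M" "G \<in> L \<inter> contact_op ` M"
    then obtain a b where ab: "a \<in> M" "F = contact_op a" "b \<in> M" "G = contact_op b"
      by blast
    then have "op_bracket F G = contact_op (bracket a b)"
      using M_A by (simp add: contact_op_bracket)
    then show "op_bracket F G \<in> L \<inter> contact_op ` M"
      using bracket_K_L[of F G] bracket_M[OF ab(1,3)] FG L_subset_K by (simp add: subset_iff)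
  qed simp
qed

text \<open>
  Modulo the square of the maximal ideal, \<open>M\<close> is spanned by \<open>f\<close> alone, while the derived algebra contains
  \<open>1\<close> and \<open>x\<^sub>1\<close>, which are independent there.
\<close>

lemma not_generated:
  assumes "contact_op f \<in> L"
  shows "lie_generated op_scale op_bracket L {contact_op sub_top, contact_op f} \<noteq> L"
proof
  assume "lie_generated op_scale op_bracket L {contact_op sub_top, contact_op f} = L"
  then have sub: "L \<subseteq> contact_op ` M"
    using generated_subset[OF assms] by blast
  have J1: "1 \<in> J" "1 + r \<in> J" and cj1: "cj (1 + r) = 1"
    using r_pos by (auto simp: J_def conj_index_def)
  have sg1: "coef (sg (1 + r)) 0 = - 1"
    using r_pos by (auto simp: sg_def contact_sign_def)
  have v: "var m \<in> A" "var 1 \<in> A" "var (1 + r) \<in> A"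
    using var_A[OF J_subset(2)] var_A[OF J_subset(1)[OF J1(1)]] var_A[OF J_subset(1)[OF J1(2)]] by auto
  have eval: "D a (var k) = D b (var k)" if "contact_op a = contact_op b" "a \<in> A" "b \<in> A" "var k \<in> A" for a b k
    using that contact_op_coef by (metis coef_inject)
  \<comment> \<open>values at two variables recover the constant term and the coefficient at \<open>x\<^sub>1\<close> of a contact function\<close>
  have at_m: "coef (D a (var m)) 0 = 2 * coef a 0" for a
    unfolding D_var(2) euler_def by (simp add: coef_sum)
  have at_1: "coef (D a (var (1 + r))) 0 = coef a (mi_unit 1)" for a
    unfolding D_var(1)[OF J1(2)] cj1 using sg1 by (simp add: coef_deriv)
  have "deriv m (var m) = 1" "deriv m (var 1 * var m) = var 1"
    using cj(6)[OF J1(1)] by (simp_all add: deriv_mult deriv_var)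
  then have L1: "contact_op 1 \<in> L" "contact_op (var 1) \<in> L"
    using deriv_m_in_L[OF v(1)] deriv_m_in_L[OF A_mult[OF v(2,1)]] by metis+
  obtain a where a: "a \<in> M" "contact_op 1 = contact_op a"
    using L1(1) sub by blast
  obtain b where b: "b \<in> M" "contact_op (var 1) = contact_op b"
    using L1(2) sub by blast
  obtain c g where a': "a = const c * f + g" "g \<in> core_square"
    using a unfolding M_def by blast
  obtain d h where b': "b = const d * f + h" "h \<in> core_square"
    using b unfolding M_def by blast
  have "coef a 0 = 1"
    using at_m[of a] at_m[of 1] eval[OF a(2) A_closed(2) M_A[OF a(1)] v(1)] two_neq_0 by simp
  then have "coef f 0 \<noteq> 0"
    using a' core_square_coef_0 by auto
  moreover have "coef b 0 = 0"
    using at_m[of b] at_m[of "var 1"] eval[OF b(2) v(2) M_A[OF b(1)] v(1)] two_neq_0 by simp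
  ultimately have "d = 0"
    using b' core_square_coef_0 by auto
  then have "coef b (mi_unit 1) = 0"
    using b' core_square_coef_unit by auto
  moreover have "coef b (mi_unit 1) = 1"
    using at_1[of b] at_1[of "var 1"] eval[OF b(2) v(2) M_A[OF b(1)] v(3)] by (simp add: coef_var_unit)
  ultimately show False
    by simp
qed

end

theorem theorem2p4p6:
  fixes r :: nat and n :: "nat \<Rightarrow> nat"
  assumes "CHAR('a::alg_closed_field) > 3"
    and "r \<ge> 1"
    and "\<And>i. i \<in> {1..2 * r + 1} \<Longrightarrow> n i > 0"
  shows "\<not> generated_by_one_and_half op_scale op_bracket
           (contact_algebra_derived r n :: 'a dp_op set)"
proof
  interpret contact "2 * r + 1" n "TYPE('a)" r
    using assms by unfold_locales auto
  assume "generated_by_one_and_half op_scale op_bracket L"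
  then obtain y where y: "y \<in> L" "lie_generated op_scale op_bracket L {contact_op sub_top, y} = L"
    using sub_top_in_L sub_top_nonzero unfolding generated_by_one_and_half_def by blast
  then obtain f where f: "f \<in> A" "y = contact_op f"
    using L_subset_K unfolding K_eq by blast
  interpret contact_element "2 * r + 1" n "TYPE('a)" r f
    using f by unfold_locales
  show False
    using not_generated y f by blast
qed

end
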